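(* Let $D$ be a virtual knot diagram (a one-component virtual link diagram) whose fundamental quandle has the presentation \[ \langle x_1, \dots, x_m \mid r_1, \dots, r_n \rangle_{\rm qdle}, \] and let $L$ be a preferred longitude of $D$, represented by a word in $x_1,\dots,x_m$ (and their inverses) with total exponent sum zero. Then the fundamental quandle of $\phi_+(D)$ has the presentation \[ \langle x_1, \dots, x_m, y \mid r_1, \dots, r_n,\ y^L = y \rangle_{\rm qdle}. \]
   Context: **Diagrams.** A virtual link diagram is a generic immersion of finitely many oriented circles in the plane (considered up to planar isotopy) whose double points are transverse and each marked either as a classical crossing (with over/under information) or as a virtual crossing (no over/under information). A classical crossing is positive if the direction of the over strand is carried to the direction of the under strand by a counterclockwise rotation through an angle less than $\pi$, and negative otherwise. **The parallel diagram $\phi_+(D)$.** Given a virtual link diagram $D$, replace every strand $s$ of $D$ by two parallel copies, $s_{\rm R}$ on the right and $s_{\rm L}$ on the left of $s$ (with respect to the orientation of $D$). The crossings are as follows. - At a virtual crossing of $D$, all four resulting crossings are virtual. - At a classical crossing of $D$ with over strand $o$ and under strand $u$: $o_{\rm R}$ and $u_{\rm R}$ cross classically with $o_{\rm R}$ over $u_{\rm R}$; $o_{\rm R}$ and $u_{\rm L}$ cross classically with $o_{\rm R}$ over $u_{\rm L}$; the crossing of $o_{\rm L}$ with $u_{\rm R}$ and that of $o_{\rm L}$ with $u_{\rm L}$ are virtual. Moreover a twist is inserted in the pair $(u_{\rm R},u_{\rm L})$ near the crossing. If the crossing of $D$ is positive, then immediately after the crossing along $u$ insert a $-1v$-twist: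 travelling along $u$, the strands $u_{\rm R},u_{\rm L}$ cross each other first at a classical crossing with $u_{\rm R}$ over $u_{\rm L}$ (a negative crossing when both are oriented parallel to $u$) and then at a virtual crossing, after which $u_{\rm R}$ is again on the right. If the crossing of $D$ is negative, then immediately before the crossing along $u$ insert a $v1$-twist: travelling along $u$, the strands $u_{\rm R},u_{\rm L}$ cross first at a virtual crossing and then at a classical crossing with $u_{\rm R}$ over $u_{\rm L}$ (a positive crossing when both are oriented parallel to $u$). Away from the crossings of $D$ the two copies are just parallel. In $\phi_+(D)$ both copies are oriented parallel to $D$. **Quandles.** A quandle is a set $X$ with a binary operation $*$ such that (i) $x*x=x$; (ii) for any $x,y$ there is a unique $z$ with $z*y=x$, written $z=x\,\overline{*}\,y$; (iii) $(x*y)*z=(x*z)*(y*z)$. Exponential notation: $x^{y}=x*y$, $x^{y^{-1}}=x\,\overline{*}\,y$, and $x^{uv}=(x^u)^v$ for words $u,v$ in quandle elements and their inverses. $\langle\,\cdot\mid\cdot\,\rangle_{\rm qdle}$ denotes the quandle given by generators and relations (the quotient of the free quandle on the generators by the congruence generated by the relations). **Fundamental quandle.** The arcs of a diagram are obtained by cutting it at the under strand of each classical crossing (arcs continue through virtual crossings and as over strands; a component with no undercrossings is one arc). The fundamental quandle $Q(D)$ is presented by one generator for each arc and, for each classical crossing, the relation $a*b=c$, where $b$ is the over arc, $a$ is the under arc on the right-hand side of $b$ and $c$ the under arc on the left-hand side of $b$. The associated group ${\rm As}(Q)$ of a quandle $Q$ is the group generated by the elements of $Q$ with relations $x*y=y^{-1}xy$;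 ${\rm As}(Q(D))$ is naturally identified with the knot group $G(D)$ of the Wirtinger presentation of $D$. **Preferred longitude.** Choose a base point on an arc of the one-component diagram $D$, with corresponding generator $x$. Travel once along $D$ from the base point, writing $b^{\varepsilon}$ each time one passes under an arc with generator $b$ at a crossing of sign $\varepsilon=\pm1$; then multiply on the right by the power $x^{-w}$, where $w$ is the sum of the signs, so that the total exponent sum is zero. The resulting element $L\in{\rm As}(Q(D))$ is a preferred longitude; for a given presentation of $Q(D)$ it is represented by a word in the generators $x_1,\dots,x_m$ and their inverses. *)

theory Defs
  imports "HOL-Algebra.Group"
begin

section \<open>Quotients by generated equivalence relations\<close>

definition generated_equiv :: "'a set \<Rightarrow> ('a \<times> 'a) set \<Rightarrow> ('a \<times> 'a) set" where
  "generated_equiv A r = {(x, y). x \<in> A \<and> y \<in> A \<and> (x, y) \<in> (r \<inter> A \<times> A \<union> (r \<inter> A \<times> A)\<inverse>)\<^sup>*}"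

definition generated_classes :: "'a set \<Rightarrow> ('a \<times> 'a) set \<Rightarrow> 'a set set" where
  "generated_classes A r = A // generated_equiv A r"

lemma equiv_generated_equiv: "equiv A (generated_equiv A r)"
proof -
  let ?s = "r \<inter> A \<times> A \<union> (r \<inter> A \<times> A)\<inverse>"
  have "sym (?s\<^sup>*)"
    by (intro sym_rtrancl) (auto simp: sym_def)
  then show ?thesis
    unfolding generated_equiv_def
    by (auto intro!: equivI simp: refl_on_def sym_def trans_def intro: rtrancl_trans)
qed

section \<open>Quandles\<close>

record 'a quandle = "'a partial_object" +
  qop :: "'a \<Rightarrow> 'a \<Rightarrow> 'a" (infixl "\<triangleright>\<index>" 70)

locale quandle =
  fixes Q (structure)
  assumes qop_closed: "\<lbrakk>x \<in> carrier Q; y \<in> carrier Q\<rbrakk> \<Longrightarrow> x \<triangleright> y \<in> carrier Q"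
    and qop_idem: "x \<in> carrier Q \<Longrightarrow> x \<triangleright> x = x"
    and qop_unique: "\<lbrakk>x \<in> carrier Q; y \<in> carrier Q\<rbrakk> \<Longrightarrow> \<exists>!z. z \<in> carrier Q \<and> z \<triangleright> y = x"
    and qop_distrib: "\<lbrakk>x \<in> carrier Q; y \<in> carrier Q; z \<in> carrier Q\<rbrakk>
        \<Longrightarrow> (x \<triangleright> y) \<triangleright> z = (x \<triangleright> z) \<triangleright> (y \<triangleright> z)"

definition quandle_iso :: "('a, 'm) quandle_scheme \<Rightarrow> ('b, 'n) quandle_scheme \<Rightarrow> ('a \<Rightarrow> 'b) set" where
  "quandle_iso P Q = {h. bij_betw h (carrier P) (carrier Q) \<and>
     (\<forall>x\<in>carrier P. \<forall>y\<in>carrier P. h (x \<triangleright>\<^bsub>P\<^esub> y) = h x \<triangleright>\<^bsub>Q\<^esub> h y)}"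

subsection \<open>Presentations\<close>

text \<open>Quandle terms; \<open>QInv s t\<close> is the unique \<open>z\<close> with \<open>z * t = s\<close>.\<close>

datatype 'g qterm = Gen 'g | QOp "'g qterm" "'g qterm" | QInv "'g qterm" "'g qterm"

text \<open>
  The least congruence (for both operations) on the terms over \<open>X\<close> that contains all instances
  of the quandle axioms and the relations \<open>R\<close>. For \<open>R = {}\<close> the quotient is the free quandle
  on \<open>X\<close>; in general it is the quotient of the free quandle by the congruence generated by \<open>R\<close>.
\<close>

inductive qcong :: "'g set \<Rightarrow> ('g qterm \<times> 'g qterm) set \<Rightarrow> 'g qterm \<Rightarrow> 'g qterm \<Rightarrow> bool"
  for X R where
  qcong_refl: "set_qterm t \<subseteq> X \<Longrightarrow> qcong X R t t"
| qcong_sym: "qcong X R s t \<Longrightarrow> qcong X R t s"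
| qcong_trans: "\<lbrakk>qcong X R s t; qcong X R t u\<rbrakk> \<Longrightarrow> qcong X R s u"
| qcong_QOp: "\<lbrakk>qcong X R s s'; qcong X R t t'\<rbrakk> \<Longrightarrow> qcong X R (QOp s t) (QOp s' t')"
| qcong_QInv: "\<lbrakk>qcong X R s s'; qcong X R t t'\<rbrakk> \<Longrightarrow> qcong X R (QInv s t) (QInv s' t')"
| qcong_idem: "set_qterm s \<subseteq> X \<Longrightarrow> qcong X R (QOp s s) s"
| qcong_QOp_QInv: "\<lbrakk>set_qterm s \<subseteq> X; set_qterm t \<subseteq> X\<rbrakk> \<Longrightarrow> qcong X R (QOp (QInv s t) t) s"
| qcong_QInv_QOp: "\<lbrakk>set_qterm s \<subseteq> X; set_qterm t \<subseteq> X\<rbrakk> \<Longrightarrow> qcong X R (QInv (QOp s t) t) s"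
| qcong_distrib: "\<lbrakk>set_qterm s \<subseteq> X; set_qterm t \<subseteq> X; set_qterm u \<subseteq> X\<rbrakk>
    \<Longrightarrow> qcong X R (QOp (QOp s t) u) (QOp (QOp s u) (QOp t u))"
| qcong_rel: "\<lbrakk>(s, t) \<in> R; set_qterm s \<subseteq> X; set_qterm t \<subseteq> X\<rbrakk> \<Longrightarrow> qcong X R s t"

definition qclass :: "'g set \<Rightarrow> ('g qterm \<times> 'g qterm) set \<Rightarrow> 'g qterm \<Rightarrow> 'g qterm set" where
  "qclass X R t = {s. qcong X R t s}"


definition presented_quandle ::
    "'g set \<Rightarrow> ('g qterm \<times> 'g qterm) set \<Rightarrow> 'g qterm set quandle" where
  "presented_quandle X R =
     \<lparr>carrier = {qclass X R t | t. set_qterm t \<subseteq> X},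
      qop = (\<lambda>A B. \<Union>s\<in>A. \<Union>t\<in>B. qclass X R (QOp s t))\<rparr>"

lemma qcong_terms: "qcong X R s t \<Longrightarrow> set_qterm s \<subseteq> X \<and> set_qterm t \<subseteq> X"
  by (induction rule: qcong.induct) auto

lemma qclass_eq_iff:
  assumes "set_qterm s \<subseteq> X"
  shows "qclass X R s = qclass X R t \<longleftrightarrow> qcong X R s t"
proof
  assume "qclass X R s = qclass X R t"
  then have "s \<in> qclass X R t"
    using qcong_refl[OF assms] by (auto simp: qclass_def)
  then show "qcong X R s t"
    by (auto simp: qclass_def intro: qcong_sym)
qed (auto simp: qclass_def intro: qcong_sym qcong_trans)

lemma qop_qclass:
  assumes "set_qterm s \<subseteq> X" "set_qterm t \<subseteq> X"
  shows "qclass X R s \<triangleright>\<^bsub>presented_quandle X R\<^esub> qclass X R t = qclass X R (QOp s t)"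
proof -
  have *: "qclass X R (QOp s' t') = qclass X R (QOp s t)"
    if "s' \<in> qclass X R s" "t' \<in> qclass X R t" for s' t'
  proof -
    have "qcong X R (QOp s t) (QOp s' t')"
      using that by (simp add: qclass_def qcong_QOp)
    then show ?thesis
      using qclass_eq_iff[of "QOp s t" X R "QOp s' t'"] assms by simp
  qed
  have "s \<in> qclass X R s" "t \<in> qclass X R t"
    using assms by (simp_all add: qclass_def qcong_refl)
  then have "(\<Union>s'\<in>qclass X R s. \<Union>t'\<in>qclass X R t. qclass X R (QOp s' t')) = qclass X R (QOp s t)"
    using * by blast
  then show ?thesis
    by (simp add: presented_quandle_def)
qed

lemma quandle_presented_quandle: "quandle (presented_quandle X R)"
proof
  let ?Q = "presented_quandle X R"
  have car: "carrier ?Q = {qclass X R t | t. set_qterm t \<subseteq> X}"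
    by (simp add: presented_quandle_def)
  fix x y assume "x \<in> carrier ?Q" "y \<in> carrier ?Q"
  then obtain s t where st: "x = qclass X R s" "y = qclass X R t" "set_qterm s \<subseteq> X" "set_qterm t \<subseteq> X"
    by (auto simp: car)
  have *: "set_qterm (QOp s t) \<subseteq> X"
    using st by auto
  show "x \<triangleright>\<^bsub>?Q\<^esub> y \<in> carrier ?Q"
    unfolding car st(1,2) qop_qclass[OF st(3,4)] using * by blast
  show "x \<triangleright>\<^bsub>?Q\<^esub> x = x"
    using st by (simp add: qop_qclass qclass_eq_iff qcong_idem)
  show "\<exists>!z. z \<in> carrier ?Q \<and> z \<triangleright>\<^bsub>?Q\<^esub> y = x"
  proof (rule ex1I[of _ "qclass X R (QInv s t)"])
    show "qclass X R (QInv s t) \<in> carrier ?Q \<and> qclass X R (QInv s t) \<triangleright>\<^bsub>?Q\<^esub> y = x"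
    proof
      show "qclass X R (QInv s t) \<in> carrier ?Q"
        unfolding car using st by (intro CollectI exI[of _ "QInv s t"]) simp
      show "qclass X R (QInv s t) \<triangleright>\<^bsub>?Q\<^esub> y = x"
        using st by (simp add: qop_qclass qclass_eq_iff qcong_QOp_QInv)
    qed
  next
    fix z assume z: "z \<in> carrier ?Q \<and> z \<triangleright>\<^bsub>?Q\<^esub> y = x"
    then obtain u where u: "z = qclass X R u" "set_qterm u \<subseteq> X"
      by (auto simp: car)
    then have "qcong X R (QOp u t) s"
      using z st by (auto simp: qop_qclass qclass_eq_iff)
    then have "qcong X R (QInv (QOp u t) t) (QInv s t)"
      using st by (simp add: qcong_QInv qcong_refl)
    then have "qcong X R u (QInv s t)"
      using qcong_QInv_QOp[of u X t R] u st by (blast intro: qcong_sym qcong_trans)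
    then show "z = qclass X R (QInv s t)"
      using u by (simp add: qclass_eq_iff)
  qed
  fix z assume "z \<in> carrier ?Q"
  then obtain u where u: "z = qclass X R u" "set_qterm u \<subseteq> X"
    by (auto simp: car)
  show "x \<triangleright>\<^bsub>?Q\<^esub> y \<triangleright>\<^bsub>?Q\<^esub> z = x \<triangleright>\<^bsub>?Q\<^esub> z \<triangleright>\<^bsub>?Q\<^esub> (y \<triangleright>\<^bsub>?Q\<^esub> z)"
    using st u by (simp add: qop_qclass qclass_eq_iff qcong_distrib)
qed

subsection \<open>Words in elements and their inverses\<close>

text \<open>The letter \<open>(x, True)\<close> stands for \<open>x\<close>, the letter \<open>(x, False)\<close> for its inverse.\<close>

type_synonym 'a signed_word = "('a \<times> bool) list"

definition exponent_sum :: "'a signed_word \<Rightarrow> int" where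
  "exponent_sum w = (\<Sum>(x, e)\<leftarrow>w. if e then 1 else -1)"

definition word_power :: "'a \<Rightarrow> int \<Rightarrow> 'a signed_word" where
  "word_power x k = replicate (nat \<bar>k\<bar>) (x, k \<ge> 0)"

fun qexp :: "'g qterm \<Rightarrow> 'g signed_word \<Rightarrow> 'g qterm" where
  "qexp t [] = t"
| "qexp t ((x, e) # w) = qexp (if e then QOp t (Gen x) else QInv t (Gen x)) w"

subsection \<open>The associated group\<close>

text \<open>
  Signed words in the elements of \<open>Q\<close>, modulo free cancellation and \<open>x * y = y\<inverse> x y\<close>.
\<close>

definition As_words :: "('a, 'm) quandle_scheme \<Rightarrow> 'a signed_word set" where
  "As_words Q = lists (carrier Q \<times> UNIV)"

definition As_steps :: "('a, 'm) quandle_scheme \<Rightarrow> ('a signed_word \<times> 'a signed_word) set" where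
  "As_steps Q =
     {(u @ [(x, e), (x, \<not> e)] @ v, u @ v) | u x e v.
        u \<in> As_words Q \<and> v \<in> As_words Q \<and> x \<in> carrier Q} \<union>
     {(u @ [(x \<triangleright>\<^bsub>Q\<^esub> y, True)] @ v, u @ [(y, False), (x, True), (y, True)] @ v) | u x y v.
        u \<in> As_words Q \<and> v \<in> As_words Q \<and> x \<in> carrier Q \<and> y \<in> carrier Q}"

definition As_class :: "('a, 'm) quandle_scheme \<Rightarrow> 'a signed_word \<Rightarrow> 'a signed_word set" where
  "As_class Q w = generated_equiv (As_words Q) (As_steps Q) `` {w}"

definition As :: "('a, 'm) quandle_scheme \<Rightarrow> 'a signed_word set monoid" where
  "As Q =
     \<lparr>carrier = generated_classes (As_words Q) (As_steps Q),
      mult = (\<lambda>A B. \<Union>u\<in>A. \<Union>v\<in>B. As_class Q (u @ v)),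
      one = As_class Q []\<rparr>"

lemma As_words_append [simp]: "u @ v \<in> As_words Q \<longleftrightarrow> u \<in> As_words Q \<and> v \<in> As_words Q"
  by (auto simp: As_words_def)

lemma As_equiv_context:
  assumes "(u, v) \<in> generated_equiv (As_words Q) (As_steps Q)" "a \<in> As_words Q" "b \<in> As_words Q"
  shows "(a @ u @ b, a @ v @ b) \<in> generated_equiv (As_words Q) (As_steps Q)"
proof -
  let ?W = "As_words Q"
  let ?r = "As_steps Q \<inter> ?W \<times> ?W"
  have ctx: "(a @ s @ b, a @ t @ b) \<in> ?r" if "(s, t) \<in> ?r" for s t
  proof -
    have "(a @ s @ b, a @ t @ b) \<in> As_steps Q"
    proof -
      from that consider
        (cancel) p x e q where "s = p @ [(x, e), (x, \<not> e)] @ q" "t = p @ q"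
          "p \<in> ?W" "q \<in> ?W" "x \<in> carrier Q"
      | (conj) p x y q where "s = p @ [(x \<triangleright>\<^bsub>Q\<^esub> y, True)] @ q"
          "t = p @ [(y, False), (x, True), (y, True)] @ q"
          "p \<in> ?W" "q \<in> ?W" "x \<in> carrier Q" "y \<in> carrier Q"
        unfolding As_steps_def by clarsimp metis
      then show ?thesis
      proof cases
        case cancel
        have "a @ s @ b = (a @ p) @ [(x, e), (x, \<not> e)] @ (q @ b)" "a @ t @ b = (a @ p) @ (q @ b)"
          "a @ p \<in> ?W" "q @ b \<in> ?W"
          using cancel assms(2,3) by simp_all
        then show ?thesis
          unfolding As_steps_def using cancel(5)
          by (intro UnI1 CollectI exI[of _ "a @ p"] exI[of _ x] exI[of _ e] exI[of _ "q @ b"]) simp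
      next
        case conj
        have "a @ s @ b = (a @ p) @ [(x \<triangleright>\<^bsub>Q\<^esub> y, True)] @ (q @ b)"
          "a @ t @ b = (a @ p) @ [(y, False), (x, True), (y, True)] @ (q @ b)"
          "a @ p \<in> ?W" "q @ b \<in> ?W"
          using conj assms(2,3) by simp_all
        then show ?thesis
          unfolding As_steps_def using conj(5,6)
          by (intro UnI2 CollectI exI[of _ "a @ p"] exI[of _ x] exI[of _ y] exI[of _ "q @ b"]) simp
      qed
    qed
    then show ?thesis
      using that assms(2,3) by simp
  qed
  have "(u, v) \<in> (?r \<union> ?r\<inverse>)\<^sup>*" and uv: "u \<in> ?W" "v \<in> ?W"
    using assms(1) by (simp_all add: generated_equiv_def)
  from this(1) have "(a @ u @ b, a @ v @ b) \<in> (?r \<union> ?r\<inverse>)\<^sup>*"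
  proof (induction rule: rtrancl_induct)
    case (step y z)
    then have "(a @ y @ b, a @ z @ b) \<in> ?r \<union> ?r\<inverse>"
      using ctx[of y z] ctx[of z y] by blast
    then show ?case
      using step.IH by (rule rtrancl_into_rtrancl[rotated])
  qed simp
  then show ?thesis
    using uv assms(2,3) by (simp add: generated_equiv_def)
qed

lemma As_class_eq_iff:
  assumes "u \<in> As_words Q" "v \<in> As_words Q"
  shows "As_class Q u = As_class Q v \<longleftrightarrow> (u, v) \<in> generated_equiv (As_words Q) (As_steps Q)"
  unfolding As_class_def by (rule eq_equiv_class_iff[OF equiv_generated_equiv assms])

lemma carrier_As: "carrier (As Q) = As_class Q ` As_words Q"
  by (auto simp: As_def generated_classes_def quotient_def As_class_def)

lemma mult_As:
  assumes "u \<in> As_words Q" "v \<in> As_words Q"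
  shows "As_class Q u \<otimes>\<^bsub>As Q\<^esub> As_class Q v = As_class Q (u @ v)"
proof -
  let ?E = "generated_equiv (As_words Q) (As_steps Q)"
  have *: "As_class Q (u' @ v') = As_class Q (u @ v)"
    if "u' \<in> As_class Q u" "v' \<in> As_class Q v" for u' v'
  proof -
    have E: "(u, u') \<in> ?E" "(v, v') \<in> ?E"
      using that by (auto simp: As_class_def)
    then have W: "u' \<in> As_words Q" "v' \<in> As_words Q"
      by (auto simp: generated_equiv_def)
    have nil: "[] \<in> As_words Q"
      by (simp add: As_words_def)
    have "(u @ v, u' @ v) \<in> ?E" "(u' @ v, u' @ v') \<in> ?E"
      using As_equiv_context[OF E(1) nil assms(2)] As_equiv_context[OF E(2) W(1) nil] by simp_all
    then have "As_class Q (u @ v) = As_class Q (u' @ v)" "As_class Q (u' @ v) = As_class Q (u' @ v')"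
      using assms W by (simp_all add: As_class_eq_iff)
    then show ?thesis
      by simp
  qed
  have "u \<in> As_class Q u" "v \<in> As_class Q v"
    unfolding As_class_def by (simp_all add: generated_equiv_def assms)
  then have "(\<Union>u'\<in>As_class Q u. \<Union>v'\<in>As_class Q v. As_class Q (u' @ v')) = As_class Q (u @ v)"
    using * by blast
  then show ?thesis
    by (simp add: As_def)
qed

lemma As_words_inverse:
  assumes "w \<in> As_words Q"
  shows "\<exists>v\<in>As_words Q. As_class Q (v @ w) = As_class Q []"
  using assms
proof (induction w)
  case Nil
  then show ?case
    by (intro bexI[of _ "[]"]) simp_all
next
  case (Cons l w)
  obtain x e where l: "l = (x, e)"
    by fastforce
  have x: "x \<in> carrier Q" and w: "w \<in> As_words Q"
    using Cons.prems l by (auto simp: As_words_def)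
  obtain v where v: "v \<in> As_words Q" "As_class Q (v @ w) = As_class Q []"
    using Cons.IH[OF w] by blast
  let ?v = "v @ [(x, \<not> e)]"
  have W: "?v \<in> As_words Q" "?v @ l # w \<in> As_words Q" "v @ w \<in> As_words Q"
    using v w x l by (auto simp: As_words_def)
  have "(?v @ l # w, v @ w) \<in> As_steps Q"
    unfolding As_steps_def using v(1) w x
    by (intro UnI1 CollectI exI[of _ v] exI[of _ x] exI[of _ "\<not> e"] exI[of _ w]) (simp add: l)
  then have "(?v @ l # w, v @ w) \<in> generated_equiv (As_words Q) (As_steps Q)"
    using W by (auto simp: generated_equiv_def)
  then have "As_class Q (?v @ l # w) = As_class Q []"
    using W v As_class_eq_iff[of "?v @ l # w" Q "v @ w"] by simp
  then show ?case
    using W by blast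
qed

lemma group_As: "group (As Q)"
proof (rule groupI)
  have nil: "[] \<in> As_words Q"
    by (simp add: As_words_def)
  have one: "\<one>\<^bsub>As Q\<^esub> = As_class Q []"
    by (simp add: As_def)
  show "\<one>\<^bsub>As Q\<^esub> \<in> carrier (As Q)"
    using nil by (simp add: one carrier_As)
  show "x \<otimes>\<^bsub>As Q\<^esub> y \<in> carrier (As Q)" if "x \<in> carrier (As Q)" "y \<in> carrier (As Q)" for x y
    using that by (auto simp: carrier_As mult_As)
  show "x \<otimes>\<^bsub>As Q\<^esub> y \<otimes>\<^bsub>As Q\<^esub> z = x \<otimes>\<^bsub>As Q\<^esub> (y \<otimes>\<^bsub>As Q\<^esub> z)"
    if "x \<in> carrier (As Q)" "y \<in> carrier (As Q)" "z \<in> carrier (As Q)" for x y z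
    using that by (auto simp: carrier_As mult_As)
  show "\<one>\<^bsub>As Q\<^esub> \<otimes>\<^bsub>As Q\<^esub> x = x" if "x \<in> carrier (As Q)" for x
    using that nil by (auto simp: carrier_As mult_As one)
  show "\<exists>y\<in>carrier (As Q). y \<otimes>\<^bsub>As Q\<^esub> x = \<one>\<^bsub>As Q\<^esub>" if x: "x \<in> carrier (As Q)" for x
  proof -
    obtain w where w: "w \<in> As_words Q" "x = As_class Q w"
      using x unfolding carrier_As by blast
    obtain v where v: "v \<in> As_words Q" "As_class Q (v @ w) = As_class Q []"
      using As_words_inverse[OF w(1)] by blast
    have "As_class Q v \<otimes>\<^bsub>As Q\<^esub> x = \<one>\<^bsub>As Q\<^esub>"
      unfolding w(2) mult_As[OF v(1) w(1)] one by (rule v(2))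
    then show ?thesis
      using v(1) unfolding carrier_As by blast
  qed
qed

section \<open>Virtual link diagrams\<close>

text \<open>
  A diagram is encoded by its underlying oriented plane graph. At every crossing, turn the
  picture so that the two strands point east and north; this names them \<open>East\<close> and \<open>North\<close>
  (the direction of \<open>East\<close> is carried to that of \<open>North\<close> by a counterclockwise rotation through
  an angle less than pi). So at a positive crossing \<open>East\<close> is over, at a negative crossing
  \<open>North\<close> is over, and at a virtual crossing neither is. A passage \<open>(c, s)\<close> is the strand \<open>s\<close>
  of the crossing \<open>c\<close>; a component is the cyclic sequence, cut open at some point, of its
  passages through classical and virtual crossings. The empty list is a circle without crossings.
\<close>

datatype strand = East | North

fun other_strand :: "strand \<Rightarrow> strand" where
  "other_strand East = North"
| "other_strand North = East"

datatype crossing_type = Positive | Negative | Virtual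

type_synonym 'c passage = "'c \<times> strand"

record 'c diagram =
  components :: "'c passage list list"
  ctype :: "'c \<Rightarrow> crossing_type"

definition passages :: "'c diagram \<Rightarrow> 'c passage set" where
  "passages D = set (concat (components D))"

definition crossings :: "'c diagram \<Rightarrow> 'c set" where
  "crossings D = fst ` passages D"

definition next_passage :: "'c diagram \<Rightarrow> ('c passage \<times> 'c passage) set" where
  "next_passage D =
     {(w ! j, w ! (Suc j mod length w)) | w j. w \<in> set (components D) \<and> j < length w}"

subsection \<open>Planarity\<close>

text \<open>
  A dart is a half-edge at a crossing. The darts \<open>((c, East), Out)\<close>, \<open>((c, North), Out)\<close>,
  \<open>((c, East), In)\<close>, \<open>((c, North), In)\<close> follow each other counterclockwise around \<open>c\<close>. The
  faces are the orbits of ``go to the other end of the edge, then turn to the next dart''.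
\<close>

datatype dart_end = In | Out

type_synonym 'c dart = "'c passage \<times> dart_end"

fun turn :: "'c dart \<Rightarrow> 'c dart" where
  "turn ((c, East), Out) = ((c, North), Out)"
| "turn ((c, North), Out) = ((c, East), In)"
| "turn ((c, East), In) = ((c, North), In)"
| "turn ((c, North), In) = ((c, East), Out)"

definition edge_ends :: "'c diagram \<Rightarrow> ('c dart \<times> 'c dart) set" where
  "edge_ends D =
     {((p, Out), (q, In)) | p q. (p, q) \<in> next_passage D} \<union>
     {((q, In), (p, Out)) | p q. (p, q) \<in> next_passage D}"

definition faces :: "'c diagram \<Rightarrow> 'c dart set set" where
  "faces D = generated_classes (passages D \<times> UNIV) {(d, turn d') | d d'. (d, d') \<in> edge_ends D}"

definition pieces :: "'c diagram \<Rightarrow> 'c set set" where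
  "pieces D = generated_classes (crossings D) {(fst p, fst q) | p q. (p, q) \<in> next_passage D}"

text \<open>
  Euler's formula, summed over the connected components (\<open>pieces\<close>) of the 4-valent graph, each
  with its own outer face: \<open>V - E + F = 2 K\<close> where \<open>E = 2 V\<close>. Each summand is at most 2, so
  equality means that every piece has genus 0. Circles without crossings are left out.
\<close>

definition planar_diagram :: "'c diagram \<Rightarrow> bool" where
  "planar_diagram D \<longleftrightarrow> card (faces D) = card (crossings D) + 2 * card (pieces D)"

definition virtual_link_diagram :: "'c diagram \<Rightarrow> bool" where
  "virtual_link_diagram D \<longleftrightarrow>
     distinct (concat (components D)) \<and>
     (\<forall>c s. (c, s) \<in> passages D \<longrightarrow> (c, other_strand s) \<in> passages D) \<and>
     planar_diagram D"

definition virtual_knot_diagram :: "'c diagram \<Rightarrow> bool" where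
  "virtual_knot_diagram D \<longleftrightarrow> virtual_link_diagram D \<and> length (components D) = 1"

subsection \<open>Fundamental quandle\<close>

text \<open>
  \<open>Into p\<close> is the edge of the plane graph that ends at the passage \<open>p\<close>; \<open>Loop i\<close> is the
  \<open>i\<close>-th component when it has no crossings.
\<close>

datatype 'c edge = Into "'c passage" | Loop nat

fun underpass :: "'c diagram \<Rightarrow> 'c passage \<Rightarrow> bool" where
  "underpass D (c, s) \<longleftrightarrow> ctype D c = Positive \<and> s = North \<or> ctype D c = Negative \<and> s = East"

definition edges :: "'c diagram \<Rightarrow> 'c edge set" where
  "edges D = Into ` passages D \<union>
     {Loop i | i. i < length (components D) \<and> components D ! i = []}"

definition same_arc :: "'c diagram \<Rightarrow> ('c edge \<times> 'c edge) set" where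
  "same_arc D = generated_equiv (edges D)
     {(Into p, Into q) | p q. (p, q) \<in> next_passage D \<and> \<not> underpass D p}"

definition arcs :: "'c diagram \<Rightarrow> 'c edge set set" where
  "arcs D = edges D // same_arc D"

definition arc_of :: "'c diagram \<Rightarrow> 'c edge \<Rightarrow> 'c edge set" where
  "arc_of D e = same_arc D `` {e}"

definition over_arc :: "'c diagram \<Rightarrow> 'c passage \<Rightarrow> 'c edge set" where
  "over_arc D p = arc_of D (Into (fst p, other_strand (snd p)))"

text \<open>
  At a positive crossing the under strand \<open>North\<close> passes from the right of \<open>East\<close> to its left;
  at a negative crossing the under strand \<open>East\<close> passes from the left of \<open>North\<close> to its right.
\<close>

definition quandle_relations :: "'c diagram \<Rightarrow> ('c edge set qterm \<times> 'c edge set qterm) set" where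
  "quandle_relations D =
     {(QOp (Gen (arc_of D (Into p))) (Gen (over_arc D p)), Gen (arc_of D (Into q))) | p q.
        (p, q) \<in> next_passage D \<and> underpass D p \<and> ctype D (fst p) = Positive} \<union>
     {(QOp (Gen (arc_of D (Into q))) (Gen (over_arc D p)), Gen (arc_of D (Into p))) | p q.
        (p, q) \<in> next_passage D \<and> underpass D p \<and> ctype D (fst p) = Negative}"

definition fundamental_quandle :: "'c diagram \<Rightarrow> 'c edge set qterm set quandle" where
  "fundamental_quandle D = presented_quandle (arcs D) (quandle_relations D)"

definition arc_element :: "'c diagram \<Rightarrow> 'c edge set \<Rightarrow> 'c edge set qterm set" where
  "arc_element D a = qclass (arcs D) (quandle_relations D) (Gen a)"

subsection \<open>Preferred longitudes\<close>

definition under_word :: "'c diagram \<Rightarrow> 'c passage list \<Rightarrow> 'c edge set qterm set signed_word" where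
  "under_word D v =
     map (\<lambda>p. (arc_element D (over_arc D p), ctype D (fst p) = Positive)) (filter (underpass D) v)"

fun start_edge :: "'c passage list \<Rightarrow> 'c edge" where
  "start_edge [] = Loop 0"
| "start_edge (p # v) = Into p"

text \<open>
  For a base point on the edge into the passage \<open>w ! k\<close>, the list \<open>rotate k w\<close> is the sequence
  of passages met when travelling once along the knot from there.
\<close>

definition preferred_longitude ::
    "'c diagram \<Rightarrow> 'c edge set qterm set signed_word set \<Rightarrow> bool" where
  "preferred_longitude D l \<longleftrightarrow>
     (\<exists>w k. components D = [w] \<and>
       (let v = rotate k w;
            u = under_word D v;
            x = arc_element D (arc_of D (start_edge v))
        in l = As_class (fundamental_quandle D) (u @ word_power x (- exponent_sum u))))"

section \<open>The parallel diagram\<close>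

text \<open>
  Over a crossing \<open>c\<close> of \<open>D\<close> lie the crossings \<open>(c, Quad a b)\<close> of the copy on side \<open>a\<close> of the
  strand \<open>East\<close> with the copy on side \<open>b\<close> of the strand \<open>North\<close>, and, if \<open>c\<close> is classical, the
  first and second crossing of the twist. The copies of \<open>East\<close> meet the left copy of \<open>North\<close>
  before the right one, the copies of \<open>North\<close> meet the right copy of \<open>East\<close> before the left one.
\<close>

datatype side = RightSide | LeftSide

datatype parallel_crossing = Quad side side | Twist1 | Twist2

fun quad_passages :: "side \<Rightarrow> 'c passage \<Rightarrow> ('c \<times> parallel_crossing) passage list" where
  "quad_passages a (c, East) = [((c, Quad a LeftSide), East), ((c, Quad a RightSide), East)]"
| "quad_passages b (c, North) = [((c, Quad RightSide b), North), ((c, Quad LeftSide b), North)]"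

text \<open>
  In the first crossing of the twist the right copy heads to the left, so it is \<open>North\<close>;
  in the second one it heads back to the right, so it is \<open>East\<close>.
\<close>

fun twist_passages :: "side \<Rightarrow> 'c \<Rightarrow> ('c \<times> parallel_crossing) passage list" where
  "twist_passages RightSide c = [((c, Twist1), North), ((c, Twist2), East)]"
| "twist_passages LeftSide c = [((c, Twist1), East), ((c, Twist2), North)]"

definition parallel_passages ::
    "'c diagram \<Rightarrow> side \<Rightarrow> 'c passage \<Rightarrow> ('c \<times> parallel_crossing) passage list" where
  "parallel_passages D a p =
     (if \<not> underpass D p then quad_passages a p
      else if ctype D (fst p) = Positive then quad_passages a p @ twist_passages a (fst p)
      else twist_passages a (fst p) @ quad_passages a p)"

text \<open>
  The right copy of the over strand (\<open>East\<close> if \<open>c\<close> is positive, \<open>North\<close> if it is negative)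
  crosses classically, the left copy virtually. The \<open>-1v\<close>-twist of a positive crossing is a
  negative crossing followed by a virtual one; the \<open>v1\<close>-twist of a negative crossing is a
  virtual crossing followed by a positive one.
\<close>

fun parallel_ctype :: "'c diagram \<Rightarrow> 'c \<times> parallel_crossing \<Rightarrow> crossing_type" where
  "parallel_ctype D (c, Quad a b) =
     (case ctype D c of
        Positive \<Rightarrow> (if a = RightSide then Positive else Virtual)
      | Negative \<Rightarrow> (if b = RightSide then Negative else Virtual)
      | Virtual \<Rightarrow> Virtual)"
| "parallel_ctype D (c, Twist1) = (if ctype D c = Positive then Negative else Virtual)"
| "parallel_ctype D (c, Twist2) = (if ctype D c = Negative then Positive else Virtual)"

definition phi_plus :: "'c diagram \<Rightarrow> ('c \<times> parallel_crossing) diagram" where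
  "phi_plus D =
     \<lparr>components = concat (map (\<lambda>w. [concat (map (parallel_passages D RightSide) w),
                                     concat (map (parallel_passages D LeftSide) w)])
                           (components D)),
      ctype = parallel_ctype D\<rparr>"

end

(* The fundamental quandle of D represents quandle colorings of D. A coloring of phi_+(D) by a
   quandle K is a coloring a of D (the right copy, which only passes under right copies) together
   with colors b of the left copy, and along the knot b is acted on by a^-e o^e at an undercrossing
   of sign e below o. Since the color of the next arc is o^-e a o^e, the factors a^-e can be
   collected at the front as a power of the initial color a0, so after one turn b has been acted on
   by a0^-w times the product of the o^e, which acts as the preferred longitude L. Hence a coloring
   of phi_+(D) amounts to a coloring of D and one more element y, the initial color of b, with
   y^L = y. *)

theory Submission
  imports Defs
begin

section \<open>Words acting on a quandle\<close>

text \<open>Colorings by a quandle are homomorphisms out of the fundamental quandle, so two of them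
  suffice: a coloring of \<open>phi_plus D\<close> by the extended presentation gives a homomorphism
  one way, and the universal coloring of \<open>phi_plus D\<close> by its own fundamental quandle
  gives values for the generators, hence a homomorphism the other way. That they are mutually
  inverse is checked on generators.

  Two obstacles shape the rest. The word \<open>L\<close> need not be the one read off the diagram;
  both merely represent the same element of the associated group. So the action of signed words must
  factor through that group in every quandle \<open>K\<close> receiving a homomorphism from Q(D),
  and on all elements of \<open>K\<close>, because the color of the left copy need not come from
  Q(D). And collecting the letters of the right copy puts the power of a0 at the front, while the
  longitude carries it at the end. With U the product of the o^e, the actions satisfy a0^k U = U
  (a0^U)^k, and a0^U = a0 after a full turn.\<close>

definition qinv :: "('a, 'm) quandle_scheme \<Rightarrow> 'a \<Rightarrow> 'a \<Rightarrow> 'a" where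
  "qinv Q x y = (THE z. z \<in> carrier Q \<and> z \<triangleright>\<^bsub>Q\<^esub> y = x)"

definition qlet :: "('a, 'm) quandle_scheme \<Rightarrow> 'a \<Rightarrow> 'a \<Rightarrow> bool \<Rightarrow> 'a" where
  "qlet Q x y e = (if e then x \<triangleright>\<^bsub>Q\<^esub> y else qinv Q x y)"

fun qact :: "('a, 'm) quandle_scheme \<Rightarrow> 'a \<Rightarrow> 'a signed_word \<Rightarrow> 'a" where
  "qact Q x [] = x"
| "qact Q x ((y, e) # w) = qact Q (qlet Q x y e) w"

lemma qact_append: "qact Q x (u @ v) = qact Q (qact Q x u) v"
  by (induction Q x u rule: qact.induct) auto

lemma exponent_sum_Nil [simp]: "exponent_sum [] = 0"
  and exponent_sum_Cons [simp]: "exponent_sum ((x, e) # w) = (if e then 1 else -1) + exponent_sum w"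
  by (simp_all add: exponent_sum_def)

lemma exponent_sum_map_apfst [simp]: "exponent_sum (map (apfst f) w) = exponent_sum w"
  by (induction w) auto

lemma map_apfst_word_power: "map (apfst f) (word_power x k) = word_power (f x) k"
  by (simp add: word_power_def)

lemma set_word_power: "set (word_power x k) \<subseteq> {x} \<times> UNIV"
  by (auto simp: word_power_def)

context quandle
begin

lemma qinv_op:
  assumes "x \<in> carrier Q" "y \<in> carrier Q"
  shows "qinv Q x y \<in> carrier Q \<and> qinv Q x y \<triangleright> y = x"
  unfolding qinv_def by (rule theI') (rule qop_unique[OF assms])

lemma qinv_eq:
  assumes "z \<in> carrier Q" "y \<in> carrier Q" "z \<triangleright> y = x"
  shows "qinv Q x y = z"
proof -
  have "x \<in> carrier Q"
    using assms qop_closed by blast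
  then show ?thesis
    using qop_unique[of x y] qinv_op[of x y] assms by blast
qed

lemma qlet_closed [simp]: "\<lbrakk>x \<in> carrier Q; y \<in> carrier Q\<rbrakk> \<Longrightarrow> qlet Q x y e \<in> carrier Q"
  by (simp add: qlet_def qinv_op qop_closed)

lemma qlet_cancel [simp]: "\<lbrakk>x \<in> carrier Q; y \<in> carrier Q\<rbrakk> \<Longrightarrow> qlet Q (qlet Q x y e) y (\<not> e) = x"
  by (simp add: qlet_def qinv_op qinv_eq)

text \<open>Acting by \<open>z\<close> or by its inverse is an automorphism. One of the four sign
  combinations is the distributivity axiom; the others reduce to it by the uniqueness of division in
  \<open>qinv_eq\<close>.\<close>

lemma qlet_distrib:
  assumes "x \<in> carrier Q" "y \<in> carrier Q" "z \<in> carrier Q"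
  shows "qlet Q (qlet Q x y e) z d = qlet Q (qlet Q x z d) (qlet Q y z d) e"
proof -
  have 1: "(u \<triangleright> v) \<triangleright> z = (u \<triangleright> z) \<triangleright> (v \<triangleright> z)" if "u \<in> carrier Q" "v \<in> carrier Q" for u v
    using qop_distrib that assms by blast
  have 2: "qinv Q u v \<triangleright> z = qinv Q (u \<triangleright> z) (v \<triangleright> z)" if "u \<in> carrier Q" "v \<in> carrier Q" for u v
    using that assms 1[of "qinv Q u v" v]
    by (intro qinv_eq[symmetric]) (simp_all add: qinv_op qop_closed)
  have 3: "qinv Q (x \<triangleright> y) z = qinv Q x z \<triangleright> qinv Q y z"
    using assms by (intro qinv_eq) (simp_all add: qinv_op qop_closed 1)
  have 4: "qinv Q (qinv Q x y) z = qinv Q (qinv Q x z) (qinv Q y z)"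
    using assms by (intro qinv_eq) (simp_all add: qinv_op qop_closed 2)
  show ?thesis
    using 1 2 3 4 assms by (simp add: qlet_def)
qed

lemma qact_closed [simp]:
  "\<lbrakk>x \<in> carrier Q; w \<in> lists (carrier Q \<times> UNIV)\<rbrakk> \<Longrightarrow> qact Q x w \<in> carrier Q"
proof (induction w arbitrary: x)
  case (Cons l w)
  then show ?case
    by (cases l) auto
qed simp

lemma qlet_qact:
  assumes "x \<in> carrier Q" "w \<in> lists (carrier Q \<times> UNIV)" "z \<in> carrier Q"
  shows "qlet Q (qact Q x w) z d = qact Q (qlet Q x z d) (map (apfst (\<lambda>y. qlet Q y z d)) w)"
  using assms
proof (induction w arbitrary: x)
  case (Cons l w)
  then show ?case
    by (cases l) (auto simp: qlet_distrib[of _ _ z])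
qed simp

lemma qact_qlet:
  assumes "x \<in> carrier Q" "y \<in> carrier Q" "w \<in> lists (carrier Q \<times> UNIV)"
  shows "qact Q (qlet Q x y e) w = qlet Q (qact Q x w) (qact Q y w) e"
  using assms
proof (induction w arbitrary: x y)
  case (Cons l w)
  then show ?case
    by (cases l) (auto simp: qlet_distrib[of x y])
qed simp

text \<open>The whole word \<open>w\<close> acts as an automorphism, so moving it in front of
  \<open>u\<close> replaces each letter of \<open>u\<close> by its image under \<open>w\<close>.
  With a power for \<open>u\<close>, this carries the power of the base color past the word of over
  letters.\<close>

lemma qact_qact:
  assumes "x \<in> carrier Q" "u \<in> lists (carrier Q \<times> UNIV)" "w \<in> lists (carrier Q \<times> UNIV)"
  shows "qact Q (qact Q x u) w = qact Q (qact Q x w) (map (apfst (\<lambda>y. qact Q y w)) u)"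
  using assms
proof (induction u arbitrary: x)
  case (Cons l u)
  obtain a e where l: "l = (a, e)"
    by fastforce
  have "qact Q (qact Q (qlet Q x a e) u) w =
      qact Q (qact Q (qlet Q x a e) w) (map (apfst (\<lambda>y. qact Q y w)) u)"
    using Cons l by auto
  then show ?case
    using Cons.prems l by (simp add: qact_qlet[of x a])
qed simp

lemma word_power_in_lists: "a \<in> carrier Q \<Longrightarrow> word_power a k \<in> lists (carrier Q \<times> UNIV)"
  using set_word_power[of a k] by fastforce

text \<open>The letters of \<open>word_power a k\<close> carry the sign of \<open>k\<close>, so a
  further letter lengthens the word if its sign agrees and cancels a letter otherwise; k = 0 is the
  empty word and is treated apart.\<close>

lemma qact_word_power_step:
  assumes "x \<in> carrier Q" "a \<in> carrier Q"
  shows "qact Q (qlet Q x a e) (word_power a k) = qact Q x (word_power a (k + (if e then 1 else -1)))"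
proof (cases "k = 0")
  case True
  then show ?thesis
    by (simp add: word_power_def)
next
  case False
  show ?thesis
  proof (cases "e = (k \<ge> 0)")
    case True
    then have "nat \<bar>k + (if e then 1 else -1)\<bar> = Suc (nat \<bar>k\<bar>)"
      using False by auto
    moreover have "(k + (if e then 1 else -1) \<ge> 0) = (k \<ge> 0)"
      using True False by auto
    ultimately show ?thesis
      using True by (simp add: word_power_def)
  next
    case ne: False
    let ?k = "k + (if e then 1 else -1)"
    have n: "nat \<bar>k\<bar> = Suc (nat \<bar>?k\<bar>)"
      using False ne by auto
    show ?thesis
    proof (cases "?k = 0")
      case True
      then show ?thesis
        using n ne assms qlet_cancel[of x a e]
        by (cases e) (auto simp: word_power_def)
    next
      case False
      then have "(?k \<ge> 0) = (k \<ge> 0)" "(k \<ge> 0) = (\<not> e)"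
        using ne \<open>k \<noteq> 0\<close> by (auto split: if_splits)
      then show ?thesis
        using n assms unfolding word_power_def by simp
    qed
  qed
qed

text \<open>The two sides of the relation x * y = y^-1 x y of the associated group act equally: in
  x^(z^-1 y z) the last z distributes over what precedes it, cancels z^-1 and turns y into y *
  z.\<close>

lemma qlet_op:
  assumes "x \<in> carrier Q" "y \<in> carrier Q" "z \<in> carrier Q"
  shows "qlet Q x (y \<triangleright> z) True = qlet Q (qlet Q (qlet Q x z False) y True) z True"
proof -
  have "qlet Q (qlet Q (qlet Q x z False) y True) z True =
      qlet Q (qlet Q (qlet Q x z False) z True) (qlet Q y z True) True"
    using assms by (intro qlet_distrib) simp_all
  also have "\<dots> = qlet Q x (y \<triangleright> z) True"
    using assms qlet_cancel[of x z False] by (simp add: qlet_def)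
  finally show ?thesis ..
qed

end

section \<open>Homomorphisms and universal properties\<close>

definition quandle_hom :: "('a, 'm) quandle_scheme \<Rightarrow> ('b, 'n) quandle_scheme \<Rightarrow> ('a \<Rightarrow> 'b) set" where
  "quandle_hom P Q = {f \<in> carrier P \<rightarrow> carrier Q.
     \<forall>x\<in>carrier P. \<forall>y\<in>carrier P. f (x \<triangleright>\<^bsub>P\<^esub> y) = f x \<triangleright>\<^bsub>Q\<^esub> f y}"

lemma quandle_hom_closed: "\<lbrakk>f \<in> quandle_hom P Q; x \<in> carrier P\<rbrakk> \<Longrightarrow> f x \<in> carrier Q"
  by (auto simp: quandle_hom_def)

lemma quandle_hom_comp:
  "\<lbrakk>f \<in> quandle_hom P Q; g \<in> quandle_hom Q K\<rbrakk> \<Longrightarrow> g \<circ> f \<in> quandle_hom P K"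
  by (auto simp: quandle_hom_def Pi_iff)

lemma quandle_iso_hom: "h \<in> quandle_iso P Q \<Longrightarrow> h \<in> quandle_hom P Q"
  by (auto simp: quandle_iso_def quandle_hom_def bij_betw_def)

lemma quandle_iso_inv:
  assumes "quandle P" "h \<in> quandle_iso P Q"
  shows "inv_into (carrier P) h \<in> quandle_hom Q P"
proof -
  interpret quandle P by fact
  have h: "bij_betw h (carrier P) (carrier Q)"
    and op: "\<And>x y. \<lbrakk>x \<in> carrier P; y \<in> carrier P\<rbrakk> \<Longrightarrow> h (x \<triangleright>\<^bsub>P\<^esub> y) = h x \<triangleright>\<^bsub>Q\<^esub> h y"
    using assms(2) by (auto simp: quandle_iso_def)
  show ?thesis
    unfolding quandle_hom_def
  proof (intro CollectI conjI ballI Pi_I)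
    show car: "inv_into (carrier P) h x \<in> carrier P" if "x \<in> carrier Q" for x
      using that h by (metis bij_betw_imp_surj_on inv_into_into)
    fix x y assume xy: "x \<in> carrier Q" "y \<in> carrier Q"
    then have "x \<triangleright>\<^bsub>Q\<^esub> y = h (inv_into (carrier P) h x \<triangleright>\<^bsub>P\<^esub> inv_into (carrier P) h y)"
      using car h by (simp add: op bij_betw_inv_into_right)
    then show "inv_into (carrier P) h (x \<triangleright>\<^bsub>Q\<^esub> y) =
        inv_into (carrier P) h x \<triangleright>\<^bsub>P\<^esub> inv_into (carrier P) h y"
      using h car xy by (simp add: bij_betw_inv_into_left qop_closed)
  qed
qed

lemma quandle_isoI:
  assumes "f \<in> quandle_hom P Q" "g \<in> quandle_hom Q P"
    and "\<And>x. x \<in> carrier P \<Longrightarrow> g (f x) = x" "\<And>x. x \<in> carrier Q \<Longrightarrow> f (g x) = x"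
  shows "f \<in> quandle_iso P Q"
  using assms unfolding quandle_iso_def quandle_hom_def by (auto intro!: bij_betwI)

lemma quandle_hom_qlet:
  assumes "f \<in> quandle_hom P Q" "quandle P" "quandle Q" "x \<in> carrier P" "y \<in> carrier P"
  shows "f (qlet P x y e) = qlet Q (f x) (f y) e"
proof -
  interpret P: quandle P by fact
  interpret Q: quandle Q by fact
  have *: "qinv P x y \<in> carrier P" "qinv P x y \<triangleright>\<^bsub>P\<^esub> y = x"
    using assms P.qinv_op by blast+
  then have "f x = f (qinv P x y) \<triangleright>\<^bsub>Q\<^esub> f y"
    using assms unfolding quandle_hom_def by fastforce
  then have "qinv Q (f x) (f y) = f (qinv P x y)"
    using assms * by (intro Q.qinv_eq) (auto simp: quandle_hom_def)
  then show ?thesis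
    using assms by (auto simp: qlet_def quandle_hom_def)
qed

lemma quandle_hom_lists:
  assumes "f \<in> quandle_hom P Q" "w \<in> lists (carrier P \<times> UNIV)"
  shows "map (apfst f) w \<in> lists (carrier Q \<times> UNIV)"
  using assms(2) by (induction w) (auto simp: quandle_hom_closed[OF assms(1)])

text \<open>The associated group of \<open>P\<close> acts on all of \<open>Q\<close> through
  \<open>f\<close>: neither free cancellation nor the conjugation relation changes the result. This
  permits exchanging a longitude word for any other word of its class.\<close>

lemma As_class_qact:
  assumes f: "f \<in> quandle_hom P Q" "quandle Q"
    and uv: "u \<in> As_words P" "v \<in> As_words P" "As_class P u = As_class P v"
    and x: "x \<in> carrier Q"
  shows "qact Q x (map (apfst f) u) = qact Q x (map (apfst f) v)"
proof -
  interpret Q: quandle Q by fact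
  note closed = quandle_hom_closed[OF f(1)]
  have invariant: "qact Q x (map (apfst f) s) = qact Q x (map (apfst f) t)" if "(s, t) \<in> As_steps P" for s t
  proof -
    have word: "qact Q x (map (apfst f) p) \<in> carrier Q" if "p \<in> As_words P" for p
      using quandle_hom_lists[OF f(1)] that x unfolding As_words_def by (intro Q.qact_closed)
    from that consider
      (cancel) p a e q where "s = p @ [(a, e), (a, \<not> e)] @ q" "t = p @ q"
        "p \<in> As_words P" "q \<in> As_words P" "a \<in> carrier P"
    | (conj) p a b q where "s = p @ [(a \<triangleright>\<^bsub>P\<^esub> b, True)] @ q"
        "t = p @ [(b, False), (a, True), (b, True)] @ q"
        "p \<in> As_words P" "q \<in> As_words P" "a \<in> carrier P" "b \<in> carrier P"
      unfolding As_steps_def by clarsimp metis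
    then show ?thesis
    proof cases
      case cancel
      then show ?thesis
        by (simp add: qact_append word closed)
    next
      case conj
      moreover from conj have "f (a \<triangleright>\<^bsub>P\<^esub> b) = f a \<triangleright>\<^bsub>Q\<^esub> f b"
        using f(1) by (simp add: quandle_hom_def)
      ultimately show ?thesis
        by (simp add: qact_append word closed Q.qlet_op)
    qed
  qed
  have "(u, v) \<in> generated_equiv (As_words P) (As_steps P)"
    using uv by (simp add: As_class_eq_iff)
  then have "(u, v) \<in> (As_steps P \<inter> As_words P \<times> As_words P \<union>
      (As_steps P \<inter> As_words P \<times> As_words P)\<inverse>)\<^sup>*"
    by (simp add: generated_equiv_def)
  then show ?thesis
  proof (induction rule: rtrancl_induct)
    case (step s t)
    then have "(s, t) \<in> As_steps P \<or> (t, s) \<in> As_steps P"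
      by blast
    then show ?case
      using step.IH invariant by metis
  qed simp
qed

fun qeval :: "('a, 'm) quandle_scheme \<Rightarrow> ('g \<Rightarrow> 'a) \<Rightarrow> 'g qterm \<Rightarrow> 'a" where
  "qeval Q \<sigma> (Gen x) = \<sigma> x"
| "qeval Q \<sigma> (QOp s t) = qeval Q \<sigma> s \<triangleright>\<^bsub>Q\<^esub> qeval Q \<sigma> t"
| "qeval Q \<sigma> (QInv s t) = qinv Q (qeval Q \<sigma> s) (qeval Q \<sigma> t)"

lemma qeval_cong: "(\<And>x. x \<in> set_qterm t \<Longrightarrow> \<sigma> x = \<tau> x) \<Longrightarrow> qeval Q \<sigma> t = qeval Q \<tau> t"
  by (induction t) auto

lemma qeval_qexp: "qeval Q \<sigma> (qexp t w) = qact Q (qeval Q \<sigma> t) (map (apfst \<sigma>) w)"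
  by (induction t w rule: qexp.induct) (auto simp: qlet_def)

lemma set_qterm_qexp: "set_qterm (qexp t w) = set_qterm t \<union> fst ` set w"
  by (induction t w rule: qexp.induct) auto

lemma (in quandle) qeval_closed:
  "\<lbrakk>\<sigma> \<in> X \<rightarrow> carrier Q; set_qterm t \<subseteq> X\<rbrakk> \<Longrightarrow> qeval Q \<sigma> t \<in> carrier Q"
  by (induction t) (auto simp: qop_closed qinv_op)

lemma quandle_hom_qeval:
  assumes "f \<in> quandle_hom P Q" "quandle P" "quandle Q" "\<sigma> \<in> X \<rightarrow> carrier P" "set_qterm t \<subseteq> X"
  shows "f (qeval P \<sigma> t) = qeval Q (f \<circ> \<sigma>) t"
  using assms(5)
proof (induction t)
  case (QOp s t)
  have "qeval P \<sigma> s \<in> carrier P" "qeval P \<sigma> t \<in> carrier P"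
    using QOp.prems assms(4) by (auto intro: quandle.qeval_closed[OF assms(2)])
  then show ?case
    using QOp assms(1) by (simp add: quandle_hom_def)
next
  case (QInv s t)
  have "qeval P \<sigma> s \<in> carrier P" "qeval P \<sigma> t \<in> carrier P"
    using QInv.prems assms(4) by (auto intro: quandle.qeval_closed[OF assms(2)])
  then show ?case
    using QInv quandle_hom_qlet[OF assms(1-3), of _ _ False] by (simp add: qlet_def)
qed simp

lemma (in quandle) qeval_qcong:
  assumes "\<sigma> \<in> X \<rightarrow> carrier Q"
    and "\<And>s t. \<lbrakk>(s, t) \<in> R; set_qterm s \<subseteq> X; set_qterm t \<subseteq> X\<rbrakk> \<Longrightarrow> qeval Q \<sigma> s = qeval Q \<sigma> t"
    and "qcong X R s t"
  shows "qeval Q \<sigma> s = qeval Q \<sigma> t"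
  using assms(3)
proof (induction rule: qcong.induct)
  case (qcong_QInv_QOp s t)
  then show ?case
    using qeval_closed[OF assms(1)] by (auto intro!: qinv_eq)
next
  case (qcong_distrib s t u)
  then show ?case
    using qeval_closed[OF assms(1)] qop_distrib[of "qeval Q \<sigma> s" "qeval Q \<sigma> t" "qeval Q \<sigma> u"]
    by simp
next
  case (qcong_rel s t)
  then show ?case
    by (rule assms(2))
qed (use qeval_closed[OF assms(1)] in \<open>auto simp: qop_idem qinv_op\<close>)

lemma carrier_presented: "carrier (presented_quandle X R) = qclass X R ` {t. set_qterm t \<subseteq> X}"
  by (auto simp: presented_quandle_def)

lemma qinv_qclass:
  assumes "set_qterm s \<subseteq> X" "set_qterm t \<subseteq> X"
  shows "qinv (presented_quandle X R) (qclass X R s) (qclass X R t) = qclass X R (QInv s t)"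
proof -
  have st: "set_qterm (QInv s t) \<subseteq> X"
    using assms by simp
  have "qclass X R u \<in> carrier (presented_quandle X R)" if "set_qterm u \<subseteq> X" for u
    using that by (simp add: carrier_presented)
  then show ?thesis
    using assms st
    by (intro quandle.qinv_eq[OF quandle_presented_quandle])
      (auto simp: qop_qclass[OF st] qclass_eq_iff qcong_QOp_QInv)
qed

lemma qeval_presented:
  "set_qterm t \<subseteq> X \<Longrightarrow> qeval (presented_quandle X R) (\<lambda>x. qclass X R (Gen x)) t = qclass X R t"
  by (induction t) (simp_all add: qop_qclass qinv_qclass)

lemma presented_quandle_hom_exists:
  assumes "quandle Q" "\<sigma> \<in> X \<rightarrow> carrier Q"
    and "\<And>s t. \<lbrakk>(s, t) \<in> R; set_qterm s \<subseteq> X; set_qterm t \<subseteq> X\<rbrakk> \<Longrightarrow> qeval Q \<sigma> s = qeval Q \<sigma> t"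
  obtains f where "f \<in> quandle_hom (presented_quandle X R) Q"
    "\<And>x. x \<in> X \<Longrightarrow> f (qclass X R (Gen x)) = \<sigma> x"
proof
  interpret Q: quandle Q by fact
  \<comment> \<open>Elements of the presented quandle are sets of terms; the choice of the
    representative is harmless because congruent terms have equal values.\<close>
  define f where "f A = qeval Q \<sigma> (SOME t. t \<in> A)" for A
  have f: "f (qclass X R t) = qeval Q \<sigma> t" if "set_qterm t \<subseteq> X" for t
  proof -
    have "t \<in> qclass X R t"
      using that by (simp add: qclass_def qcong_refl)
    then have "(SOME s. s \<in> qclass X R t) \<in> qclass X R t"
      by (rule someI)
    then have "qcong X R t (SOME s. s \<in> qclass X R t)"
      by (simp add: qclass_def)
    then show ?thesis
      unfolding f_def by (intro Q.qeval_qcong[OF assms(2,3), symmetric])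
  qed
  have f_op: "f (qclass X R (QOp s t)) = f (qclass X R s) \<triangleright>\<^bsub>Q\<^esub> f (qclass X R t)"
    if "set_qterm s \<subseteq> X" "set_qterm t \<subseteq> X" for s t
    using that by (simp add: f)
  show "f \<in> quandle_hom (presented_quandle X R) Q"
    unfolding quandle_hom_def
    by (auto simp: carrier_presented qop_qclass f_op f Q.qeval_closed[OF assms(2)])
  show "f (qclass X R (Gen x)) = \<sigma> x" if "x \<in> X" for x
    using that by (simp add: f)
qed

lemma presented_quandle_hom_eq:
  assumes "f \<in> quandle_hom (presented_quandle X R) Q" "g \<in> quandle_hom (presented_quandle X R) Q"
    and "quandle Q" "\<And>x. x \<in> X \<Longrightarrow> f (qclass X R (Gen x)) = g (qclass X R (Gen x))"
    and "A \<in> carrier (presented_quandle X R)"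
  shows "f A = g A"
proof -
  let ?\<sigma> = "\<lambda>x. qclass X R (Gen x)"
  have \<sigma>: "?\<sigma> \<in> X \<rightarrow> carrier (presented_quandle X R)"
    by (auto simp: carrier_presented)
  obtain t where t: "set_qterm t \<subseteq> X" "A = qclass X R t"
    using assms(5) by (auto simp: carrier_presented)
  have "f A = qeval Q (f \<circ> ?\<sigma>) t" "g A = qeval Q (g \<circ> ?\<sigma>) t"
    using quandle_hom_qeval[OF assms(1) quandle_presented_quandle assms(3) \<sigma> t(1)]
      quandle_hom_qeval[OF assms(2) quandle_presented_quandle assms(3) \<sigma> t(1)] t
    by (simp_all add: qeval_presented)
  moreover have "qeval Q (f \<circ> ?\<sigma>) t = qeval Q (g \<circ> ?\<sigma>) t"
    using assms(4) t(1) by (intro qeval_cong) auto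
  ultimately show ?thesis
    by simp
qed

section \<open>Colorings of diagrams\<close>

fun opposite :: "'c passage \<Rightarrow> 'c passage" where
  "opposite (c, s) = (c, other_strand s)"

definition crossing_closed :: "'c diagram \<Rightarrow> bool" where
  "crossing_closed D \<longleftrightarrow> (\<forall>p\<in>passages D. opposite p \<in> passages D)"

text \<open>Colors sit on edges, not on arcs: constancy along an arc becomes a local rule at the
  passages that are not underpasses, so a coloring of \<open>phi_plus D\<close> can be checked block
  by block without computing its arcs. Solving both crossing relations for the outgoing under edge
  gives one formula, in which the sign selects the operation or its inverse.\<close>

definition coloring :: "'c diagram \<Rightarrow> ('a, 'm) quandle_scheme \<Rightarrow> ('c edge \<Rightarrow> 'a) \<Rightarrow> bool" where
  "coloring D Q a \<longleftrightarrow> a \<in> edges D \<rightarrow> carrier Q \<and>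
     (\<forall>(p, q)\<in>next_passage D. a (Into q) =
        (if underpass D p then qlet Q (a (Into p)) (a (Into (opposite p))) (ctype D (fst p) = Positive)
         else a (Into p)))"

definition edge_element :: "'c diagram \<Rightarrow> 'c edge \<Rightarrow> 'c edge set qterm set" where
  "edge_element D e = arc_element D (arc_of D e)"

lemma next_passage_passages:
  assumes "(p, q) \<in> next_passage D"
  shows "p \<in> passages D \<and> q \<in> passages D"
proof -
  obtain w j where w: "w \<in> set (components D)" "j < length w" "p = w ! j" "q = w ! (Suc j mod length w)"
    using assms unfolding next_passage_def by blast
  then have "Suc j mod length w < length w"
    by (intro mod_less_divisor) linarith
  then have "p \<in> set w" "q \<in> set w"
    using w by simp_all
  then show ?thesis
    using w(1) unfolding passages_def by auto
qed

lemma arc_of_in_arcs: "e \<in> edges D \<Longrightarrow> arc_of D e \<in> arcs D"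
  by (auto simp: arcs_def arc_of_def quotient_def)

lemma over_arc_opposite: "over_arc D p = arc_of D (Into (opposite p))"
  by (cases p) (simp add: over_arc_def)

lemma quandle_fundamental_quandle: "quandle (fundamental_quandle D)"
  unfolding fundamental_quandle_def by (rule quandle_presented_quandle)

lemma edge_element_closed: "e \<in> edges D \<Longrightarrow> edge_element D e \<in> carrier (fundamental_quandle D)"
  by (auto simp: edge_element_def arc_element_def fundamental_quandle_def carrier_presented
      arc_of_in_arcs)

lemma underpass_type:
  "underpass D p \<Longrightarrow> ctype D (fst p) = Positive \<or> ctype D (fst p) = Negative"
  by (cases p) auto

lemma same_arc_next:
  assumes "(p, q) \<in> next_passage D" "\<not> underpass D p"
  shows "arc_of D (Into p) = arc_of D (Into q)"
proof -
  let ?r = "{(Into p, Into q) | p q. (p, q) \<in> next_passage D \<and> \<not> underpass D p} \<inter> edges D \<times> edges D"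
  have e: "Into p \<in> edges D" "Into q \<in> edges D"
    using next_passage_passages[OF assms(1)] by (simp_all add: edges_def)
  then have "(Into p, Into q) \<in> ?r \<union> ?r\<inverse>"
    using assms by blast
  then have "(Into p, Into q) \<in> same_arc D"
    using e unfolding same_arc_def generated_equiv_def by blast
  then show ?thesis
    unfolding arc_of_def same_arc_def by (rule equiv_class_eq[OF equiv_generated_equiv])
qed

lemma quandle_relationsI:
  assumes "(p, q) \<in> next_passage D" "underpass D p"
  shows "ctype D (fst p) = Positive \<Longrightarrow>
      (QOp (Gen (arc_of D (Into p))) (Gen (over_arc D p)), Gen (arc_of D (Into q))) \<in> quandle_relations D"
    and "ctype D (fst p) = Negative \<Longrightarrow>
      (QOp (Gen (arc_of D (Into q))) (Gen (over_arc D p)), Gen (arc_of D (Into p))) \<in> quandle_relations D"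
  using assms unfolding quandle_relations_def by blast+

text \<open>The universal coloring: the defining relations are the coloring rule itself, at a
  negative crossing after division by the over color.\<close>

lemma coloring_edge_element:
  assumes "crossing_closed D"
  shows "coloring D (fundamental_quandle D) (edge_element D)"
  unfolding coloring_def
proof (intro conjI ballI Pi_I, simp add: edge_element_closed, clarify)
  let ?X = "arcs D" and ?R = "quandle_relations D"
  fix p q assume pq: "(p, q) \<in> next_passage D"
  have p: "p \<in> passages D" "q \<in> passages D" "opposite p \<in> passages D"
    using next_passage_passages[OF pq] assms by (auto simp: crossing_closed_def)
  then have arcs: "arc_of D (Into p) \<in> ?X" "arc_of D (Into q) \<in> ?X" "arc_of D (Into (opposite p)) \<in> ?X"
    by (auto simp: arc_of_in_arcs edges_def)
  show "edge_element D (Into q) =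
      (if underpass D p
       then qlet (fundamental_quandle D) (edge_element D (Into p)) (edge_element D (Into (opposite p)))
              (ctype D (fst p) = Positive)
       else edge_element D (Into p))"
  proof (cases "underpass D p")
    case False
    then show ?thesis
      using same_arc_next[OF pq] by (simp add: edge_element_def)
  next
    case True
    from underpass_type[OF this] show ?thesis
    proof
      assume pos: "ctype D (fst p) = Positive"
      have "qcong ?X ?R (QOp (Gen (arc_of D (Into p))) (Gen (over_arc D p))) (Gen (arc_of D (Into q)))"
        using arcs quandle_relationsI(1)[OF pq True pos]
        by (intro qcong_rel) (simp_all add: over_arc_opposite)
      from qcong_sym[OF this] show ?thesis
        using True pos arcs
        by (simp add: edge_element_def arc_element_def fundamental_quandle_def qlet_def qop_qclass
            over_arc_opposite qclass_eq_iff)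
    next
      assume neg: "ctype D (fst p) = Negative"
      have "qcong ?X ?R (QOp (Gen (arc_of D (Into q))) (Gen (over_arc D p))) (Gen (arc_of D (Into p)))"
        using arcs quandle_relationsI(2)[OF pq True neg]
        by (intro qcong_rel) (simp_all add: over_arc_opposite)
      then have "edge_element D (Into q) \<triangleright>\<^bsub>fundamental_quandle D\<^esub> edge_element D (Into (opposite p)) =
          edge_element D (Into p)"
        using arcs
        by (simp add: edge_element_def arc_element_def fundamental_quandle_def qop_qclass
            over_arc_opposite qclass_eq_iff)
      moreover have "edge_element D (Into q) \<in> carrier (fundamental_quandle D)"
        "edge_element D (Into (opposite p)) \<in> carrier (fundamental_quandle D)"
        using p by (simp_all add: edge_element_closed edges_def)
      ultimately have "qinv (fundamental_quandle D) (edge_element D (Into p))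
          (edge_element D (Into (opposite p))) = edge_element D (Into q)"
        by (intro quandle.qinv_eq[OF quandle_fundamental_quandle])
      then show ?thesis
        using True neg by (simp add: qlet_def)
    qed
  qed
qed

lemma coloring_same_arc:
  assumes "coloring D Q a" "(e, e') \<in> same_arc D"
  shows "a e = a e'"
proof -
  let ?r = "{(Into p, Into q) | p q. (p, q) \<in> next_passage D \<and> \<not> underpass D p} \<inter> edges D \<times> edges D"
  have "(e, e') \<in> (?r \<union> ?r\<inverse>)\<^sup>*"
    using assms(2) by (simp add: same_arc_def generated_equiv_def)
  then show ?thesis
  proof (induction rule: rtrancl_induct)
    case (step d d')
    then obtain p q where "(p, q) \<in> next_passage D" "\<not> underpass D p"
      "d = Into p \<and> d' = Into q \<or> d = Into q \<and> d' = Into p"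
      by blast
    then show ?case
      using assms(1) step.IH by (auto simp: coloring_def)
  qed simp
qed

text \<open>A coloring is constant on arcs, so it assigns values to the generators, and these
  satisfy the defining relations.\<close>

lemma coloring_hom_exists:
  assumes Q: "quandle Q" and D: "crossing_closed D" and a: "coloring D Q a"
  obtains f where "f \<in> quandle_hom (fundamental_quandle D) Q"
    "\<And>e. e \<in> edges D \<Longrightarrow> f (edge_element D e) = a e"
proof -
  interpret Q: quandle Q by fact
  define \<sigma> where "\<sigma> A = a (SOME e. e \<in> A)" for A
  have \<sigma>: "\<sigma> (arc_of D e) = a e" if "e \<in> edges D" for e
  proof -
    have "e \<in> arc_of D e"
      using that by (simp add: arc_of_def same_arc_def generated_equiv_def)
    then have "(SOME e'. e' \<in> arc_of D e) \<in> arc_of D e"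
      by (rule someI)
    then show ?thesis
      unfolding \<sigma>_def using coloring_same_arc[OF a] by (metis ImageE arc_of_def singletonD)
  qed
  have car: "a e \<in> carrier Q" if "e \<in> edges D" for e
    using a that by (auto simp: coloring_def)
  have \<sigma>_car: "\<sigma> \<in> arcs D \<rightarrow> carrier Q"
  proof
    fix A assume "A \<in> arcs D"
    then obtain e where "e \<in> edges D" "A = arc_of D e"
      by (auto simp: arcs_def arc_of_def quotient_def)
    then show "\<sigma> A \<in> carrier Q"
      by (simp add: \<sigma> car)
  qed
  have "qeval Q \<sigma> s = qeval Q \<sigma> t" if "(s, t) \<in> quandle_relations D" for s t
  proof -
    from that obtain p q where pq: "(p, q) \<in> next_passage D" "underpass D p"
      and st: "ctype D (fst p) = Positive \<and>
            s = QOp (Gen (arc_of D (Into p))) (Gen (over_arc D p)) \<and> t = Gen (arc_of D (Into q)) \<or>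
          ctype D (fst p) = Negative \<and>
            s = QOp (Gen (arc_of D (Into q))) (Gen (over_arc D p)) \<and> t = Gen (arc_of D (Into p))"
      unfolding quandle_relations_def by blast
    have "Into p \<in> edges D" "Into q \<in> edges D" "Into (opposite p) \<in> edges D"
      using next_passage_passages[OF pq(1)] D by (auto simp: crossing_closed_def edges_def)
    moreover have "a (Into q) = qlet Q (a (Into p)) (a (Into (opposite p))) (ctype D (fst p) = Positive)"
      using a pq by (fastforce simp: coloring_def)
    ultimately show ?thesis
      using st by (auto simp: over_arc_opposite \<sigma> qlet_def Q.qinv_op car)
  qed
  then obtain f where f: "f \<in> quandle_hom (fundamental_quandle D) Q"
    "\<And>A. A \<in> arcs D \<Longrightarrow> f (arc_element D A) = \<sigma> A"
    using presented_quandle_hom_exists[OF Q \<sigma>_car, of "quandle_relations D"]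
    unfolding fundamental_quandle_def arc_element_def by metis
  then show ?thesis
    using that by (simp add: edge_element_def arc_of_in_arcs \<sigma>)
qed

lemma coloring_hom_eq:
  assumes "f \<in> quandle_hom (fundamental_quandle D) Q" "g \<in> quandle_hom (fundamental_quandle D) Q"
    and "quandle Q" "\<And>e. e \<in> edges D \<Longrightarrow> f (edge_element D e) = g (edge_element D e)"
    and "x \<in> carrier (fundamental_quandle D)"
  shows "f x = g x"
proof (rule presented_quandle_hom_eq[OF assms(1,2)[unfolded fundamental_quandle_def] assms(3)])
  fix A assume "A \<in> arcs D"
  then obtain e where "e \<in> edges D" "A = arc_of D e"
    by (auto simp: arcs_def arc_of_def quotient_def)
  then show "f (qclass (arcs D) (quandle_relations D) (Gen A)) =
      g (qclass (arcs D) (quandle_relations D) (Gen A))"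
    using assms(4)[of e] by (simp add: edge_element_def arc_element_def)
qed (use assms(5) in \<open>simp add: fundamental_quandle_def\<close>)

lemma coloring_hom_comp:
  assumes a: "coloring D P a" and f: "f \<in> quandle_hom P Q" and "quandle P" "quandle Q" "crossing_closed D"
  shows "coloring D Q (f \<circ> a)"
proof -
  have car: "a e \<in> carrier P" if "e \<in> edges D" for e
    using a that by (auto simp: coloring_def)
  have "(f \<circ> a) (Into q) =
        (if underpass D p then qlet Q ((f \<circ> a) (Into p)) ((f \<circ> a) (Into (opposite p))) (ctype D (fst p) = Positive)
         else (f \<circ> a) (Into p))" if pq: "(p, q) \<in> next_passage D" for p q
  proof -
    have "Into p \<in> edges D" "Into (opposite p) \<in> edges D"
      using next_passage_passages[OF pq] assms(5) by (auto simp: crossing_closed_def edges_def)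
    moreover have "a (Into q) =
        (if underpass D p then qlet P (a (Into p)) (a (Into (opposite p))) (ctype D (fst p) = Positive)
         else a (Into p))"
      using a pq by (fastforce simp: coloring_def)
    ultimately show ?thesis
      by (simp add: quandle_hom_qlet[OF f assms(3,4)] car)
  qed
  then show ?thesis
    unfolding coloring_def using car f by (auto simp: quandle_hom_def)
qed

section \<open>Passages of the parallel diagram\<close>

text \<open>Adjacent pairs, with the last entry linked to \<open>z\<close>. Taking \<open>z\<close>
  as the head gives the cyclic successor relation of a component; leaving it free makes induction
  and concatenation possible.\<close>

fun links :: "'b list \<Rightarrow> 'b \<Rightarrow> ('b \<times> 'b) set" where
  "links [] z = {}"
| "links (x # xs) z = insert (x, hd (xs @ [z])) (links xs z)"

lemma links_zip: "links xs z = set (zip xs (tl xs @ [z]))"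
proof (induction xs)
  case (Cons x xs)
  then show ?case
    by (cases xs) auto
qed simp

lemma links_append: "links (xs @ ys) z = links xs (hd (ys @ [z])) \<union> links ys z"
  by (induction xs) (simp_all add: hd_append)

lemma links_rotate: "links (rotate k w) (hd (rotate k w)) = links w (hd w)"
proof (induction k)
  case (Suc k)
  have "links (rotate1 u) (hd (rotate1 u)) = links u (hd u)" for u :: "'a list"
    by (cases u) (auto simp: links_append)
  then show ?case
    using Suc by simp
qed simp

text \<open>After expanding entries into blocks, a link stays inside a block or leads from its end
  to the start of the next one; the blocks are nonempty, so that start exists.\<close>

lemma links_concat_map:
  assumes "\<And>p. f p \<noteq> []"
  shows "links (concat (map f w)) (hd (f z)) = (\<Union>(p, q)\<in>links w z. links (f p) (hd (f q)))"
proof (induction w)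
  case (Cons p w)
  have "hd (concat (map f w) @ [hd (f z)]) = hd (f (hd (w @ [z])))"
    using assms by (cases w) auto
  then show ?case
    using Cons by (simp add: links_append)
qed simp

lemma next_passage_links: "next_passage D = (\<Union>w\<in>set (components D). links w (hd w))"
proof -
  have "links w (hd w) = {(w ! j, w ! (Suc j mod length w)) | j. j < length w}" for w :: "'a passage list"
  proof (cases w)
    case (Cons p u)
    then have "links w (hd w) = set (zip w (rotate1 w))"
      by (simp add: links_zip del: links.simps)
    also have "\<dots> = {(w ! j, rotate1 w ! j) | j. j < length w}"
      by (auto simp: set_zip)
    also have "\<dots> = {(w ! j, w ! (Suc j mod length w)) | j. j < length w}"
      using nth_rotate1[of _ w] by (intro Collect_cong) metis
    finally show ?thesis .
  qed simp
  then show ?thesis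
    unfolding next_passage_def by blast
qed

lemma successor_exists:
  assumes "p \<in> passages D"
  obtains q where "(p, q) \<in> next_passage D"
proof -
  obtain w j where "w \<in> set (components D)" "j < length w" "p = w ! j"
    using assms by (auto simp: passages_def in_set_conv_nth)
  then have "(p, w ! (Suc j mod length w)) \<in> next_passage D"
    unfolding next_passage_def by blast
  then show ?thesis
    by (rule that)
qed

lemma parallel_passages_nonempty: "parallel_passages D s p \<noteq> []"
  by (cases p; cases "snd p") (auto simp: parallel_passages_def)

lemma set_components_phi_plus:
  "set (components (phi_plus D)) =
     (\<Union>w\<in>set (components D). range (\<lambda>s. concat (map (parallel_passages D s) w)))"
proof -
  have UNIV_side: "UNIV = {RightSide, LeftSide}"
    by (rule UNIV_eq_I) (metis side.exhaust insertCI)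
  show ?thesis
    unfolding UNIV_side by (simp add: phi_plus_def)
qed

lemma passages_phi_plus: "passages (phi_plus D) = (\<Union>p\<in>passages D. \<Union>s. set (parallel_passages D s p))"
  unfolding passages_def set_concat set_components_phi_plus by auto

text \<open>Localizes the parallel diagram: later checks concern a single block and the entrance to
  the next block of the same copy.\<close>

lemma next_passage_phi_plus:
  "next_passage (phi_plus D) =
     (\<Union>(p, q)\<in>next_passage D. \<Union>s. links (parallel_passages D s p) (hd (parallel_passages D s q)))"
proof -
  have "links (concat (map (parallel_passages D s) w)) (hd (concat (map (parallel_passages D s) w))) =
      (\<Union>(p, q)\<in>links w (hd w). links (parallel_passages D s p) (hd (parallel_passages D s q)))" for s w
  proof (cases w)
    case (Cons p u)
    then have "hd (concat (map (parallel_passages D s) w)) = hd (parallel_passages D s (hd w))"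
      by (simp add: parallel_passages_nonempty)
    then show ?thesis
      by (simp only: links_concat_map[of "parallel_passages D s" w "hd w", OF parallel_passages_nonempty])
  qed simp
  then show ?thesis
    unfolding next_passage_links set_components_phi_plus by auto
qed

lemma ctype_phi_plus [simp]: "ctype (phi_plus D) = parallel_ctype D"
  by (simp add: phi_plus_def)

lemma crossing_closed_phi_plus:
  assumes "crossing_closed D"
  shows "crossing_closed (phi_plus D)"
  unfolding crossing_closed_def
proof
  fix P assume "P \<in> passages (phi_plus D)"
  then obtain c t s where p: "(c, t) \<in> passages D" and P: "P \<in> set (parallel_passages D s (c, t))"
    by (auto simp: passages_phi_plus)
  \<comment> \<open>At a \<open>Quad\<close> crossing the two strands are copies of the two
    different strands of \<open>c\<close>, so the opposite passage may lie over the other passage of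
    \<open>D\<close>.\<close>
  have both: "(c, r) \<in> passages D" for r
    using p assms by (cases r; cases t) (auto simp: crossing_closed_def)
  have cross: "((c, Quad x y), r) \<in> passages (phi_plus D)" for x y r
  proof -
    have "((c, Quad x y), r) \<in> set (parallel_passages D (if r = East then x else y) (c, r))"
      by (cases r; cases x; cases y) (auto simp: parallel_passages_def)
    then show ?thesis
      unfolding passages_phi_plus using both by blast
  qed
  \<comment> \<open>The strands of a twist are the two copies of the same under strand, so both
    passages lie over \<open>(c, t)\<close>.\<close>
  have twist: "((c, x), r) \<in> passages (phi_plus D)" if "x \<in> {Twist1, Twist2}" "underpass D (c, t)" for x r
  proof -
    have "((c, x), r) \<in> set (twist_passages (if (x = Twist1) = (r = East) then LeftSide else RightSide) c)"
      using that(1) by (cases r) auto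
    then have "((c, x), r) \<in>
        set (parallel_passages D (if (x = Twist1) = (r = East) then LeftSide else RightSide) (c, t))"
      using that(2) by (simp add: parallel_passages_def)
    then show ?thesis
      unfolding passages_phi_plus using p by blast
  qed
  from P show "opposite P \<in> passages (phi_plus D)"
    by (cases t; cases s) (auto simp: parallel_passages_def cross twist split: if_splits)
qed

text \<open>An edge of \<open>D\<close> is represented by the entrance of the block that it leads
  into. For a knot without crossings the right and left copies are the components 0 and 1 of
  \<open>phi_plus D\<close>.\<close>

fun copy_edge :: "'c diagram \<Rightarrow> side \<Rightarrow> 'c edge \<Rightarrow> ('c \<times> parallel_crossing) edge" where
  "copy_edge D s (Into p) = Into (hd (parallel_passages D s p))"
| "copy_edge D s (Loop i) = Loop (if s = RightSide then 0 else 1)"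

lemma edges_phi_plus_knot:
  assumes "components D = [w]"
  shows "edges (phi_plus D) = Into ` passages (phi_plus D) \<union> (if w = [] then {Loop 0, Loop 1} else {})"
proof -
  have "components (phi_plus D) =
      [concat (map (parallel_passages D RightSide) w), concat (map (parallel_passages D LeftSide) w)]"
    using assms by (simp add: phi_plus_def)
  moreover have "concat (map (parallel_passages D s) w) = [] \<longleftrightarrow> w = []" for s
    by (cases w) (simp_all add: parallel_passages_nonempty)
  ultimately show ?thesis
    unfolding edges_def by (auto simp: less_Suc_eq nth_Cons')
qed

lemma copy_edge_closed:
  assumes "components D = [w]" "e \<in> edges D"
  shows "copy_edge D s e \<in> edges (phi_plus D)"
proof (cases e)
  case (Into p)
  then have "p \<in> passages D"
    using assms(2) by (auto simp: edges_def)
  moreover have "hd (parallel_passages D s p) \<in> set (parallel_passages D s p)"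
    by (simp add: parallel_passages_nonempty)
  ultimately show ?thesis
    using Into by (auto simp: edges_phi_plus_knot[OF assms(1)] passages_phi_plus)
next
  case (Loop i)
  then show ?thesis
    using assms by (auto simp: edges_phi_plus_knot[OF assms(1)] edges_def[of D])
qed

section \<open>Colorings of the parallel diagram\<close>

text \<open>
  Crossings and twist together: passing \<open>p\<close> acts by this word on the color of the left copy, where
  \<open>a\<close> is the color of the right copy. At a positive crossing the twist comes last, and the letter
  of the right copy is moved to the front by distributivity.
\<close>

definition twist_word :: "'c diagram \<Rightarrow> ('c edge \<Rightarrow> 'a) \<Rightarrow> 'c passage \<Rightarrow> 'a signed_word" where
  "twist_word D a p =
     (if underpass D p
      then [(a (Into p), ctype D (fst p) \<noteq> Positive), (a (Into (opposite p)), ctype D (fst p) = Positive)]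
      else [])"

definition parallel_transport ::
    "'c diagram \<Rightarrow> ('a, 'm) quandle_scheme \<Rightarrow> ('c edge \<Rightarrow> 'a) \<Rightarrow> ('c edge \<Rightarrow> 'a) \<Rightarrow> bool" where
  "parallel_transport D Q a b \<longleftrightarrow>
     (\<forall>(p, q)\<in>next_passage D. b (Into q) = qact Q (b (Into p)) (twist_word D a p))"

text \<open>The colors forced inside a block by the colors \<open>a\<close>, \<open>b\<close> at its
  entrance. Only right copies of over strands act, so a copy of an under strand changes color at one
  of its two \<open>Quad\<close> crossings: the first one if the crossing is positive, with the
  twist behind; the last one if it is negative, with the twist in front. In the twist the left copy
  passes under the right one, which produces the extra letter of the right copy.\<close>

fun parallel_color ::
    "'c diagram \<Rightarrow> ('a, 'm) quandle_scheme \<Rightarrow> ('c edge \<Rightarrow> 'a) \<Rightarrow> ('c edge \<Rightarrow> 'a) \<Rightarrow>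
     ('c \<times> parallel_crossing) edge \<Rightarrow> 'a" where
  "parallel_color D Q a b (Loop i) = (if i = 0 then a (Loop 0) else b (Loop 0))"
| "parallel_color D Q a b (Into ((c, Quad s t), East)) =
     (if s = RightSide then a (Into (c, East))
      else if ctype D c = Negative then qlet Q (b (Into (c, East))) (a (Into (c, East))) True
      else b (Into (c, East)))"
| "parallel_color D Q a b (Into ((c, Quad s t), North)) =
     (let x = (if t = RightSide then a else b) (Into (c, North))
      in if ctype D c = Positive \<and> s = LeftSide then qlet Q x (a (Into (c, East))) True else x)"
| "parallel_color D Q a b (Into ((c, Twist1), t)) =
     (let f = (if t = North then a else b)
      in if ctype D c = Positive then qlet Q (f (Into (c, North))) (a (Into (c, East))) True
      else f (Into (c, East)))"
| "parallel_color D Q a b (Into ((c, Twist2), East)) =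
     (if ctype D c = Positive then qlet Q (a (Into (c, North))) (a (Into (c, East))) True
      else a (Into (c, East)))"
| "parallel_color D Q a b (Into ((c, Twist2), North)) =
     (if ctype D c = Positive
      then qlet Q (qlet Q (b (Into (c, North))) (a (Into (c, East))) True)
             (qlet Q (a (Into (c, North))) (a (Into (c, East))) True) False
      else b (Into (c, East)))"

lemma parallel_color_copy_edge:
  "parallel_color D Q a b (Into (hd (parallel_passages D s p))) =
     (if s = RightSide then a else b) (Into p)"
proof -
  obtain c t where "p = (c, t)"
    by fastforce
  then show ?thesis
    by (cases t; cases "ctype D c"; cases s) (auto simp: parallel_passages_def)
qed

lemma coloring_parallel_color:
  assumes Q: "quandle Q" and D: "components D = [w]" "crossing_closed D"
    and a: "coloring D Q a" and b: "b \<in> edges D \<rightarrow> carrier Q" "parallel_transport D Q a b"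
  shows "coloring (phi_plus D) Q (parallel_color D Q a b)"
  unfolding coloring_def
proof (intro conjI Pi_I)
  interpret Q: quandle Q by fact
  have a_car: "a e \<in> carrier Q" if "e \<in> edges D" for e
    using a that by (auto simp: coloring_def)
  have b_car: "b e \<in> carrier Q" if "e \<in> edges D" for e
    using b that by auto
  have edges: "Into (c, t) \<in> edges D" "Into (c, other_strand t) \<in> edges D" if "(c, t) \<in> passages D" for c t
    using that D(2) by (auto simp: edges_def crossing_closed_def)
  {
    fix E assume E: "E \<in> edges (phi_plus D)"
    show "parallel_color D Q a b E \<in> carrier Q"
    proof (cases "\<exists>i. E = Loop i")
      case True
      then show ?thesis
        using E D(1) a_car b_car by (auto simp: edges_phi_plus_knot edges_def[of D] split: if_splits)
    next
      case False
      then obtain P c t s where "(c, t) \<in> passages D" "E = Into P" "P \<in> set (parallel_passages D s (c, t))"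
        using E D(1) by (auto simp: edges_phi_plus_knot passages_phi_plus split: if_splits)
      then show ?thesis
        using edges[of c t] a_car b_car
        by (cases t; cases s; cases "ctype D c") (auto simp: parallel_passages_def Let_def)
    qed
  next
    have step: "parallel_color D Q a b (Into P') =
        (if underpass (phi_plus D) P
         then qlet Q (parallel_color D Q a b (Into P)) (parallel_color D Q a b (Into (opposite P)))
                (ctype (phi_plus D) (fst P) = Positive)
         else parallel_color D Q a b (Into P))"
      if pq: "(p, q) \<in> next_passage D"
        and P: "(P, P') \<in> links (parallel_passages D s p) (hd (parallel_passages D s q))" for p q s P P'
    proof -
      obtain c t where p: "p = (c, t)"
        by fastforce
      define z where "z = hd (parallel_passages D s q)"
      have z: "parallel_color D Q a b (Into z) = (if s = RightSide then a else b) (Into q)"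
        unfolding z_def by (rule parallel_color_copy_edge)
      have car: "a (Into (c, r)) \<in> carrier Q" "b (Into (c, r)) \<in> carrier Q" for r
        using edges[of c t] next_passage_passages[OF pq] a_car b_car p by (cases t; cases r; auto)+
      have aq: "a (Into q) = (if underpass D p
          then qlet Q (a (Into p)) (a (Into (opposite p))) (ctype D (fst p) = Positive) else a (Into p))"
        using a pq unfolding coloring_def by fastforce
      have bq: "b (Into q) = qact Q (b (Into p)) (twist_word D a p)"
        using b(2) pq unfolding parallel_transport_def by fastforce
      \<comment> \<open>At a positive crossing the twist acts by the right color after the crossing.
        With o the color of \<open>East\<close>, the identity is (b^o)^((a^o)^-1) =
        (b^(a^-1))^o.\<close>
      note dist = Q.qlet_distrib[OF car(2)[of North] car(1)[of North] car(1)[of East], of False True]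
      show ?thesis
        using P[folded z_def] aq bq z p dist car
        by (cases t; cases "ctype D c"; cases s) (auto simp: parallel_passages_def twist_word_def Let_def)
    qed
    show "\<forall>(P, P')\<in>next_passage (phi_plus D). parallel_color D Q a b (Into P') =
        (if underpass (phi_plus D) P
         then qlet Q (parallel_color D Q a b (Into P)) (parallel_color D Q a b (Into (opposite P)))
                (ctype (phi_plus D) (fst P) = Positive)
         else parallel_color D Q a b (Into P))"
      unfolding next_passage_phi_plus using step by blast
  }
qed

text \<open>Restricting a coloring to the entrances of the blocks loses nothing: inside a block each
  color follows from the preceding one once the color of the over strand is known. The latter is
  read in another block, so over passages are treated before underpasses.\<close>

lemma coloring_phi_plusD:
  assumes Q: "quandle Q" and D: "components D = [w]" "crossing_closed D"
    and f: "coloring (phi_plus D) Q f"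
  defines "a \<equiv> f \<circ> copy_edge D RightSide" and "b \<equiv> f \<circ> copy_edge D LeftSide"
  shows "coloring D Q a" and "b \<in> edges D \<rightarrow> carrier Q" and "parallel_transport D Q a b"
    and "\<And>E. E \<in> edges (phi_plus D) \<Longrightarrow> f E = parallel_color D Q a b E"
proof -
  interpret Q: quandle Q by fact
  have car: "a e \<in> carrier Q" "b e \<in> carrier Q" if "e \<in> edges D" for e
    using f copy_edge_closed[OF D(1) that] by (auto simp: a_def b_def coloring_def)
  then show b_car: "b \<in> edges D \<rightarrow> carrier Q"
    by blast
  have step: "\<forall>(P, P')\<in>links (parallel_passages D s p) (hd (parallel_passages D s q)).
      f (Into P') = (if underpass (phi_plus D) P
         then qlet Q (f (Into P)) (f (Into (opposite P))) (ctype (phi_plus D) (fst P) = Positive)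
         else f (Into P))" if "(p, q) \<in> next_passage D" for p q s
    using f that unfolding coloring_def next_passage_phi_plus by blast
  have copies: "f (Into (hd (parallel_passages D s p))) = (if s = RightSide then a else b) (Into p)" for s p
    by (cases s) (simp_all add: a_def b_def)
  have over: "(if s = RightSide then a else b) (Into q) = (if s = RightSide then a else b) (Into p) \<and>
      (\<forall>P\<in>set (parallel_passages D s p). f (Into P) = (if s = RightSide then a else b) (Into p))"
    if pq: "(p, q) \<in> next_passage D" and "\<not> underpass D p" for p q s
  proof -
    obtain c t where "p = (c, t)"
      by fastforce
    moreover define z where "z = hd (parallel_passages D s q)"
    ultimately show ?thesis
      using that(2) step[OF pq, of s, folded z_def] copies[of s p] copies[of s q, folded z_def]
      by (cases t; cases "ctype D c"; cases s) (auto simp: parallel_passages_def)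
  qed
  have under: "(s = RightSide \<longrightarrow> a (Into q) = qlet Q (a (Into p)) (a (Into (opposite p))) (ctype D (fst p) = Positive)) \<and>
      (s = LeftSide \<longrightarrow> b (Into q) = qact Q (b (Into p)) (twist_word D a p)) \<and>
      (\<forall>P\<in>set (parallel_passages D s p). f (Into P) = parallel_color D Q a b (Into P))"
    if pq: "(p, q) \<in> next_passage D" and "underpass D p" for p q s
  proof -
    obtain c t where p: "p = (c, t)"
      by fastforce
    have op: "opposite p \<in> passages D" "p \<in> passages D"
      using next_passage_passages[OF pq] D(2) by (auto simp: crossing_closed_def)
    have "\<not> underpass D (opposite p)"
      using that(2) p by (cases t) auto
    \<comment> \<open>The over color is met inside the block of \<open>opposite p\<close>, where it
      is constant along the right copy.\<close>
    then have "f (Into P) = a (Into (opposite p))"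
      if "P \<in> set (parallel_passages D RightSide (opposite p))" for P
      using op(1) over[of "opposite p" _ RightSide] that by (metis successor_exists)
    note o = this
    have car': "a (Into (c, r)) \<in> carrier Q" "b (Into (c, r)) \<in> carrier Q" for r
      using op car p by (cases t; cases r; auto simp: edges_def)+
    note dist = Q.qlet_distrib[OF car'(2)[of North] car'(1)[of North] car'(1)[of East], of False True]
    define z where "z r = hd (parallel_passages D r q)" for r
    show ?thesis
      using that(2) step[OF pq, of RightSide, folded z_def] step[OF pq, of LeftSide, folded z_def]
        copies[of RightSide p] copies[of LeftSide p] p o dist
        copies[of RightSide q, folded z_def] copies[of LeftSide q, folded z_def]
      by (cases t; cases "ctype D c"; cases s) (auto simp: parallel_passages_def twist_word_def Let_def)
  qed
  show "coloring D Q a"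
    unfolding coloring_def using car over[of _ _ RightSide] under[of _ _ RightSide] by auto
  show "parallel_transport D Q a b"
    unfolding parallel_transport_def
  proof clarify
    fix c t c' t' assume pq: "((c, t), (c', t')) \<in> next_passage D"
    then show "b (Into (c', t')) = qact Q (b (Into (c, t))) (twist_word D a (c, t))"
      using over[OF pq, of LeftSide] under[OF pq, of LeftSide]
      by (cases "underpass D (c, t)") (simp_all add: twist_word_def del: underpass.simps)
  qed
  fix E assume E: "E \<in> edges (phi_plus D)"
  show "f E = parallel_color D Q a b E"
  proof (cases "\<exists>i. E = Loop i")
    case True
    then show ?thesis
      using E D(1) by (auto simp: edges_phi_plus_knot a_def b_def split: if_splits)
  next
    case False
    then obtain P c t s where P: "(c, t) \<in> passages D" "E = Into P" "P \<in> set (parallel_passages D s (c, t))"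
      using E D(1) by (auto simp: edges_phi_plus_knot passages_phi_plus split: if_splits)
    obtain q where q: "((c, t), q) \<in> next_passage D"
      using successor_exists[OF P(1)] .
    show ?thesis
    proof (cases "underpass D (c, t)")
      case True
      then show ?thesis
        using under[OF q True] P by blast
    next
      case False
      then have "parallel_color D Q a b (Into P) = (if s = RightSide then a else b) (Into (c, t))"
        using P(3) by (cases t; cases "ctype D c"; cases s) (auto simp: parallel_passages_def)
      then show ?thesis
        using over[OF q False] P by simp
    qed
  qed
qed

section \<open>The longitude\<close>

text \<open>The word of \<open>under_word\<close> for an arbitrary coloring in place of the
  universal one, so that homomorphisms can be applied letter by letter.\<close>

definition under_letters :: "'c diagram \<Rightarrow> ('c edge \<Rightarrow> 'a) \<Rightarrow> 'c passage list \<Rightarrow> 'a signed_word" where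
  "under_letters D a v =
     map (\<lambda>p. (a (Into (opposite p)), ctype D (fst p) = Positive)) (filter (underpass D) v)"

lemma under_letters_Nil [simp]: "under_letters D a [] = []"
  and under_letters_Cons [simp]: "under_letters D a (p # v) =
    (if underpass D p then [(a (Into (opposite p)), ctype D (fst p) = Positive)] else []) @ under_letters D a v"
  by (simp_all add: under_letters_def)

lemma under_word_letters: "under_word D v = under_letters D (edge_element D) v"
  by (simp add: under_word_def under_letters_def edge_element_def over_arc_opposite)

lemma map_under_letters: "map (apfst f) (under_letters D a v) = under_letters D (f \<circ> a) v"
  by (simp add: under_letters_def)

lemma under_letters_closed:
  "(\<And>p. p \<in> set v \<Longrightarrow> a (Into (opposite p)) \<in> A) \<Longrightarrow> under_letters D a v \<in> lists (A \<times> UNIV)"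
  by (induction v) auto

text \<open>
  Moving every letter of the color of the right copy to the front of the twist words turns it into
  the color \<open>a\<^sub>0\<close> at the starting point; this is where the power in the longitude comes from.
\<close>

lemma (in quandle) qact_twist_words:
  assumes "x \<in> carrier Q" "\<And>p. p \<in> set v \<Longrightarrow> a (Into (opposite p)) \<in> carrier Q"
    and "a (Into (hd (v @ [z]))) \<in> carrier Q"
    and "\<And>p q. (p, q) \<in> links v z \<Longrightarrow> a (Into q) =
        (if underpass D p then qlet Q (a (Into p)) (a (Into (opposite p))) (ctype D (fst p) = Positive)
         else a (Into p))"
  shows "qact Q x (concat (map (twist_word D a) v)) =
      qact Q x (word_power (a (Into (hd (v @ [z])))) (- exponent_sum (under_letters D a v)) @
        under_letters D a v)"
    and "a (Into z) = qact Q (a (Into (hd (v @ [z])))) (under_letters D a v)"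
  using assms
proof (induction v arbitrary: x)
  case Nil
  {
    case 1
    then show ?case
      by (simp add: word_power_def)
  next
    case 2
    then show ?case
      by simp
  }
next
  case (Cons p v)
  define a0 a1 d e o' where "a0 = a (Into p)" and "a1 = a (Into (hd (v @ [z])))"
    and "d = - exponent_sum (under_letters D a v)"
    and "e = (ctype D (fst p) = Positive)" and "o' = a (Into (opposite p))"
  have main: "qact Q x (concat (map (twist_word D a) (p # v))) =
      qact Q x (word_power (a (Into (hd ((p # v) @ [z])))) (- exponent_sum (under_letters D a (p # v))) @
        under_letters D a (p # v)) \<and>
      a (Into z) = qact Q (a (Into (hd ((p # v) @ [z])))) (under_letters D a (p # v))"
    if x: "x \<in> carrier Q" and o: "\<And>p'. p' \<in> set (p # v) \<Longrightarrow> a (Into (opposite p')) \<in> carrier Q"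
      and a0: "a (Into (hd ((p # v) @ [z]))) \<in> carrier Q"
      and step: "\<And>p' q. (p', q) \<in> links (p # v) z \<Longrightarrow> a (Into q) =
        (if underpass D p' then qlet Q (a (Into p')) (a (Into (opposite p'))) (ctype D (fst p') = Positive)
         else a (Into p'))" for x
  proof -
    have car: "a0 \<in> carrier Q" "o' \<in> carrier Q"
      using a0 o[of p] by (simp_all add: a0_def o'_def)
    have a1: "a1 = (if underpass D p then qlet Q a0 o' e else a0)"
      using step[of p "hd (v @ [z])"] by (simp add: a1_def a0_def e_def o'_def)
    then have a1_car: "a (Into (hd (v @ [z]))) \<in> carrier Q"
      using car by (simp add: a1_def)
    have step': "\<And>p' q. (p', q) \<in> links v z \<Longrightarrow> a (Into q) =
        (if underpass D p' then qlet Q (a (Into p')) (a (Into (opposite p'))) (ctype D (fst p') = Positive)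
         else a (Into p'))"
      using step by simp
    have o': "\<And>p'. p' \<in> set v \<Longrightarrow> a (Into (opposite p')) \<in> carrier Q"
      using o by simp
    note IH = Cons.IH(1)[OF _ o' a1_car step', folded a1_def d_def]
      Cons.IH(2)[OF _ o' a1_car step', folded a1_def]
    show ?thesis
    proof (cases "underpass D p")
      case False
      then have "twist_word D a p = []"
        by (simp add: twist_word_def)
      then show ?thesis
        using IH[OF x] a1 False by (simp add: a0_def d_def)
    next
      case True
      define u where "u = qlet Q x a0 (\<not> e)"
      have u: "u \<in> carrier Q"
        using x car by (simp add: u_def)
      have tw: "twist_word D a p = [(a0, \<not> e), (o', e)]"
        using True by (simp add: twist_word_def a0_def e_def o'_def)
      have U: "under_letters D a (p # v) = (o', e) # under_letters D a v"
        using True by (simp add: e_def o'_def)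
      \<comment> \<open>Since a1 = a0^(o^e), acting by o^e and then a1^d equals acting by a0^d and
        then o^e: the power moves ahead of the letter and is rewritten in the earlier color.\<close>
      have "qact Q (qlet Q u o' e) (word_power a1 d) =
          qact Q (qlet Q u o' e) (map (apfst (\<lambda>y. qlet Q y o' e)) (word_power a0 d))"
        using a1 True by (simp add: map_apfst_word_power)
      also have "\<dots> = qlet Q (qact Q u (word_power a0 d)) o' e"
        using u car by (simp add: qlet_qact word_power_in_lists)
      also have "qact Q u (word_power a0 d) =
          qact Q x (word_power a0 (- exponent_sum (under_letters D a (p # v))))"
      proof -
        \<comment> \<open>The twist letter has exponent -e, exactly what the new letter o^e adds to
          minus the exponent sum.\<close>
        have "d + (if \<not> e then 1 else -1) = - exponent_sum (under_letters D a (p # v))"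
          unfolding U by (simp add: d_def)
        then show ?thesis
          by (simp only: u_def qact_word_power_step[OF x car(1)])
      qed
      finally have pow: "qact Q (qlet Q u o' e) (word_power a1 d) =
          qlet Q (qact Q x (word_power a0 (- exponent_sum (under_letters D a (p # v))))) o' e" .
      have "qact Q x (concat (map (twist_word D a) (p # v))) =
          qact Q (qlet Q u o' e) (concat (map (twist_word D a) v))"
        by (simp add: tw u_def)
      also have "\<dots> = qact Q (qact Q (qlet Q u o' e) (word_power a1 d)) (under_letters D a v)"
        using IH(1)[of "qlet Q u o' e"] u car by (simp add: qact_append)
      also have "\<dots> = qact Q x (word_power a0 (- exponent_sum (under_letters D a (p # v))) @
          under_letters D a (p # v))"
        unfolding pow qact_append U qact.simps ..
      finally show ?thesis
        using IH(2)[OF x] a1 True U by (simp add: a0_def)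
    qed
  qed
  {
    case 1
    then show ?case
      using main[of x] by blast
  next
    case 2
    then show ?case
      using main[of x] by blast
  }
qed

text \<open>The links close up here, so the second claim of \<open>qact_twist_words\<close> says
  that the over letters fix the starting color; hence the power passes from the front to the end
  with its base unchanged.\<close>

lemma (in quandle) qact_twist_words_cyclic:
  assumes "x \<in> carrier Q" "\<And>p. p \<in> set v \<Longrightarrow> a (Into (opposite p)) \<in> carrier Q"
    and "\<And>p. p \<in> set v \<Longrightarrow> a (Into p) \<in> carrier Q"
    and "\<And>p q. (p, q) \<in> links v (hd v) \<Longrightarrow> a (Into q) =
        (if underpass D p then qlet Q (a (Into p)) (a (Into (opposite p))) (ctype D (fst p) = Positive)
         else a (Into p))"
  shows "qact Q x (concat (map (twist_word D a) v)) =
      qact Q x (under_letters D a v @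
        word_power (a (start_edge v)) (- exponent_sum (under_letters D a v)))"
proof (cases v)
  case Nil
  then show ?thesis
    by (simp add: word_power_def)
next
  case (Cons p u)
  let ?U = "under_letters D a v" and ?a = "a (Into p)"
  have v: "hd v = p" "hd (v @ [hd v]) = p" "start_edge v = Into p"
    using Cons by simp_all
  have car: "?a \<in> carrier Q" "?U \<in> lists (carrier Q \<times> UNIV)"
    using assms(2,3) Cons by (auto intro!: under_letters_closed)
  have "a (Into (hd (v @ [hd v]))) \<in> carrier Q"
    using car by (simp only: v(2))
  note * = qact_twist_words[OF assms(1,2) this assms(4), unfolded v(2), unfolded v]
  have "qact Q x (concat (map (twist_word D a) v)) =
      qact Q (qact Q x (word_power ?a (- exponent_sum ?U))) ?U"
    by (simp only: *(1) qact_append)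
  also have "\<dots> = qact Q (qact Q x ?U) (word_power (qact Q ?a ?U) (- exponent_sum ?U))"
    by (simp only: qact_qact[OF assms(1) word_power_in_lists[OF car(1)] car(2)] map_apfst_word_power)
  also have "qact Q ?a ?U = ?a"
    using *(2) ..
  finally show ?thesis
    by (simp add: v qact_append)
qed

lemma transport_unique:
  assumes "\<And>p q. (p, q) \<in> links v (hd v) \<Longrightarrow> b (Into q) = F p (b (Into p))"
    and "\<And>p q. (p, q) \<in> links v (hd v) \<Longrightarrow> b' (Into q) = F p (b' (Into p))"
    and "b (start_edge v) = b' (start_edge v)" "p \<in> set v"
  shows "b (Into p) = b' (Into p)"
proof -
  have "b (Into (v ! j)) = b' (Into (v ! j))" if "j < length v" for j
    using that
  proof (induction j)
    case 0
    then show ?case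
      using assms(3) by (cases v) simp_all
  next
    case (Suc j)
    then have "(v ! j, v ! Suc j) \<in> links v (hd v)"
      unfolding links_zip set_zip by (auto simp: nth_append nth_tl intro!: exI[of _ j])
    then show ?case
      using assms(1,2) Suc by simp
  qed
  then show ?thesis
    using assms(4) by (metis in_set_conv_nth)
qed

lemma transport_end:
  assumes "\<And>p q. (p, q) \<in> links v z \<Longrightarrow> b (Into q) = qact Q (b (Into p)) (\<tau> p)"
  shows "qact Q (b (Into (hd (v @ [z])))) (concat (map \<tau> v)) = b (Into z)"
  using assms
proof (induction v)
  case (Cons p v)
  have "b (Into (hd (v @ [z]))) = qact Q (b (Into p)) (\<tau> p)"
    using Cons.prems by simp
  moreover have "qact Q (b (Into (hd (v @ [z])))) (concat (map \<tau> v)) = b (Into z)"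
    using Cons by simp
  ultimately show ?case
    by (simp add: qact_append)
qed simp

text \<open>The color at \<open>p\<close> is \<open>y\<close> acted on by the words met before
  \<open>p\<close>; distinctness makes that position unique. That the total word fixes
  \<open>y\<close> closes the link from the last passage to the first. The explicit formula is kept
  in the conclusion to show later that the colors lie in the carrier.\<close>

lemma transport_exists:
  assumes "distinct v" "qact Q y (concat (map \<tau> v)) = y"
  obtains b where "b (start_edge v) = y" "\<And>i. b (Loop i) = y"
    "\<And>p q. (p, q) \<in> links v (hd v) \<Longrightarrow> b (Into q) = qact Q (b (Into p)) (\<tau> p)"
    "\<And>p. b (Into p) = qact Q y (concat (map \<tau> (takeWhile (\<lambda>r. r \<noteq> p) v)))"
proof -
  define b where "b E = (case E of Into p \<Rightarrow> qact Q y (concat (map \<tau> (takeWhile (\<lambda>r. r \<noteq> p) v)))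
      | Loop _ \<Rightarrow> y)" for E
  have b_nth: "b (Into (v ! j)) = qact Q y (concat (map \<tau> (take j v)))" if "j < length v" for j
  proof -
    have "takeWhile (\<lambda>r. r \<noteq> v ! j) v = take j v"
      using assms(1) that by (intro takeWhile_eq_take_P_nth) (auto simp: nth_eq_iff_index_eq)
    then show ?thesis
      by (simp add: b_def)
  qed
  have "b (Into q) = qact Q (b (Into p)) (\<tau> p)" if pq: "(p, q) \<in> links v (hd v)" for p q
  proof -
    obtain j where j: "j < length v" "p = v ! j" "q = (tl v @ [hd v]) ! j"
      using pq by (auto simp: links_zip set_zip)
    have "b (Into q) = qact Q y (concat (map \<tau> (take (Suc j) v)))"
    proof (cases "Suc j < length v")
      case True
      then have "j < length (tl v)"
        by simp
      then have "q = v ! Suc j"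
        using j(3) by (simp add: nth_append nth_tl)
      then show ?thesis
        using b_nth[OF True] by simp
    next
      case False
      then have "q = v ! 0" "take (Suc j) v = v"
        using j by (cases v; simp add: nth_append)+
      then show ?thesis
        using b_nth[of 0] j(1) assms(2) by (cases v) simp_all
    qed
    then show ?thesis
      using j b_nth by (simp add: take_Suc_conv_app_nth qact_append)
  qed
  moreover have "b (start_edge v) = y"
    by (cases v) (simp_all add: b_def)
  ultimately show ?thesis
    using that[of b] by (simp add: b_def)
qed

text \<open>The successor relation is cyclic, so the component may be cut open at the base point of
  the longitude.\<close>

lemma knot_rotate:
  assumes "components D = [w]" "v = rotate k w"
  shows "next_passage D = links v (hd v)" "passages D = set v"
    "edges D = Into ` set v \<union> (if v = [] then {Loop 0} else {})" "start_edge v \<in> edges D"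
proof -
  show 1: "passages D = set v"
    using assms by (simp add: passages_def)
  show "next_passage D = links v (hd v)"
    using assms by (simp add: next_passage_links links_rotate)
  show 2: "edges D = Into ` set v \<union> (if v = [] then {Loop 0} else {})"
    using assms(1) unfolding edges_def 1 by (auto simp: assms(2))
  show "start_edge v \<in> edges D"
    unfolding 2 by (cases v) auto
qed

text \<open>The cyclic lemma turns the total twist word into the longitude word read off the
  diagram, and \<open>As_class_qact\<close> exchanges that word for \<open>l\<close>.\<close>

lemma longitude_action:
  assumes K: "quandle K" and f: "f \<in> quandle_hom (fundamental_quandle D) K"
    and D: "crossing_closed D" "components D = [w]" and v: "v = rotate k w"
    and l: "l \<in> As_words (fundamental_quandle D)"
      "As_class (fundamental_quandle D) l = As_class (fundamental_quandle D)
         (under_word D v @ word_power (edge_element D (start_edge v)) (- exponent_sum (under_word D v)))"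
    and x: "x \<in> carrier K"
  shows "qact K x (concat (map (twist_word D (f \<circ> edge_element D)) v)) = qact K x (map (apfst f) l)"
proof -
  let ?Q = "fundamental_quandle D" and ?a = "f \<circ> edge_element D"
  let ?u = "under_word D v @ word_power (edge_element D (start_edge v)) (- exponent_sum (under_word D v))"
  interpret K: quandle K by fact
  note knot = knot_rotate[OF D(2) v]
  have closed: "edge_element D e \<in> carrier ?Q" "?a e \<in> carrier K" if "e \<in> edges D" for e
    using edge_element_closed[OF that] quandle_hom_closed[OF f] by simp_all
  have edge: "Into p \<in> edges D" "Into (opposite p) \<in> edges D" if "p \<in> set v" for p
    using that D(1) knot(2) by (auto simp: edges_def crossing_closed_def)
  have "coloring D K ?a"
    by (rule coloring_hom_comp[OF coloring_edge_element[OF D(1)] f quandle_fundamental_quandle K D(1)])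
  then have step: "?a (Into q) = (if underpass D p
      then qlet K (?a (Into p)) (?a (Into (opposite p))) (ctype D (fst p) = Positive) else ?a (Into p))"
    if "(p, q) \<in> links v (hd v)" for p q
    using that unfolding coloring_def knot(1) by blast
  have "qact K x (concat (map (twist_word D ?a) v)) =
      qact K x (under_letters D ?a v @
        word_power (?a (start_edge v)) (- exponent_sum (under_letters D ?a v)))"
    using x closed(2) edge step by (intro K.qact_twist_words_cyclic) blast+
  also have "\<dots> = qact K x (map (apfst f) ?u)"
    unfolding under_word_letters map_append map_under_letters[symmetric] exponent_sum_map_apfst
      map_apfst_word_power by simp
  also have "\<dots> = qact K x (map (apfst f) l)"
  proof (rule As_class_qact[OF f K _ l(1) l(2)[symmetric] x])
    show "?u \<in> As_words ?Q"
      using closed(1) edge knot(4) quandle.word_power_in_lists[OF quandle_fundamental_quandle]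
      unfolding As_words_append unfolding As_words_def under_word_letters
      by (intro conjI under_letters_closed) blast+
  qed
  finally show ?thesis .
qed

lemma parallel_color_cong:
  assumes D: "components D = [w]" "crossing_closed D" and E: "E \<in> edges (phi_plus D)"
    and eq: "\<And>e. e \<in> edges D \<Longrightarrow> a e = a' e" "\<And>e. e \<in> edges D \<Longrightarrow> b e = b' e"
  shows "parallel_color D Q a b E = parallel_color D Q a' b' E"
proof (cases "\<exists>i. E = Loop i")
  case True
  then show ?thesis
    using E D(1) eq by (auto simp: edges_phi_plus_knot edges_def[of D] split: if_splits)
next
  case False
  then obtain P c t s where P: "(c, t) \<in> passages D" "E = Into P" "P \<in> set (parallel_passages D s (c, t))"
    using E D(1) by (auto simp: edges_phi_plus_knot passages_phi_plus split: if_splits)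
  have "Into (c, r) \<in> edges D" for r
    using P(1) D(2) by (cases r; cases t) (auto simp: edges_def crossing_closed_def)
  then show ?thesis
    using P(2,3) eq
    by (cases t; cases s; cases "ctype D c") (auto simp: parallel_passages_def Let_def)
qed

lemma parallel_color_copy:
  assumes "components D = [w]" "e \<in> edges D"
  shows "parallel_color D Q a b (copy_edge D s e) = (if s = RightSide then a else b) e"
proof (cases e)
  case (Into p)
  then show ?thesis
    by (simp add: parallel_color_copy_edge)
next
  case (Loop i)
  then show ?thesis
    using assms by (auto simp: edges_def)
qed

lemma twist_word_cong:
  "\<lbrakk>a (Into p) = a' (Into p); a (Into (opposite p)) = a' (Into (opposite p))\<rbrakk>
    \<Longrightarrow> twist_word D a p = twist_word D a' p"
  by (simp add: twist_word_def)

theorem theorem5p4: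
  fixes D :: "'c diagram"
    and X :: "'x set" and R :: "('x qterm \<times> 'x qterm) set" and y :: 'x
    and h :: "'x qterm set \<Rightarrow> 'c edge set qterm set"
    and L :: "'x signed_word"
  assumes "virtual_knot_diagram D"
    and "finite X" and "finite R"
    and "\<forall>(s, t) \<in> R. set_qterm s \<subseteq> X \<and> set_qterm t \<subseteq> X"
    and "h \<in> quandle_iso (presented_quandle X R) (fundamental_quandle D)"
    and "L \<in> lists (X \<times> UNIV)" and "exponent_sum L = 0"
    and "preferred_longitude D
           (As_class (fundamental_quandle D) (map (\<lambda>(x, e). (h (qclass X R (Gen x)), e)) L))"
    and "y \<notin> X"
  shows "\<exists>g. g \<in> quandle_iso
           (presented_quandle (insert y X) (insert (qexp (Gen y) L, Gen y) R))
           (fundamental_quandle (phi_plus D))"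
proof -

  \<comment> \<open>Notation, and the longitude as a word in the fundamental quandle\<close>
  define P where "P = presented_quandle X R"
  define Q where "Q = fundamental_quandle D"
  define Q' where "Q' = fundamental_quandle (phi_plus D)"
  define X' R' where "X' = insert y X" and "R' = insert (qexp (Gen y) L, Gen y) R"
  define P' where "P' = presented_quandle X' R'"
  define gen where "gen x = qclass X' R' (Gen x)" for x
  define \<kappa> \<kappa>' where "\<kappa> = edge_element D" and "\<kappa>' = edge_element (phi_plus D)"
  define hX where "hX x = h (qclass X R (Gen x))" for x
  define l where "l = map (apfst hX) L"
  have quandles: "quandle P" "quandle Q" "quandle Q'" "quandle P'"
    by (simp_all add: P_def Q_def Q'_def P'_def quandle_presented_quandle quandle_fundamental_quandle)
  have "crossing_closed D"
    using assms(1) by (auto simp: virtual_knot_diagram_def virtual_link_diagram_def crossing_closed_def)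
  then have closed: "crossing_closed D" "crossing_closed (phi_plus D)"
    using crossing_closed_phi_plus by blast+
  have l_def': "map (\<lambda>(x, e). (h (qclass X R (Gen x)), e)) L = l"
    unfolding l_def by (intro map_cong) (auto simp: hX_def)
  obtain w k where w: "components D = [w]"
    and "As_class Q l = As_class Q (under_word D (rotate k w) @ word_power
      (arc_element D (arc_of D (start_edge (rotate k w)))) (- exponent_sum (under_word D (rotate k w))))"
    using assms(8) unfolding preferred_longitude_def l_def' Q_def[symmetric] Let_def by blast
  moreover define v where "v = rotate k w"
  ultimately have l_class: "As_class Q l =
      As_class Q (under_word D v @ word_power (\<kappa> (start_edge v)) (- exponent_sum (under_word D v)))"
    by (simp add: \<kappa>_def edge_element_def)
  note knot = knot_rotate[OF w v_def]
  have "distinct v"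
    using assms(1) w by (simp add: v_def virtual_knot_diagram_def virtual_link_diagram_def)
  have h: "h \<in> quandle_hom P Q"
    using assms(5) by (simp add: P_def Q_def quandle_iso_hom)
  have genP: "qclass X R (Gen x) \<in> carrier P" if "x \<in> X" for x
    using that by (simp add: P_def carrier_presented)
  have hX: "hX x \<in> carrier Q" if "x \<in> X" for x
    unfolding hX_def by (rule quandle_hom_closed[OF h genP[OF that]])
  have l_word: "l \<in> As_words Q"
    using assms(6) unfolding l_def As_words_def by (induction L) (auto simp: hX)
  have map_l: "map (apfst f) l = map (apfst g) L" if "\<And>x. x \<in> X \<Longrightarrow> f (hX x) = g x"
    for f :: "'c edge set qterm set \<Rightarrow> 'q" and g
    using assms(6) that unfolding l_def by (induction L) auto
  \<comment> \<open>Kept general in \<open>K\<close>: in \<open>P'\<close> it makes the left colors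
    close up, in \<open>Q'\<close> it verifies the new relation.\<close>
  have action: "qact K x (concat (map (twist_word D (f \<circ> \<kappa>)) v)) = qact K x (map (apfst f) l)"
    if "quandle K" "f \<in> quandle_hom Q K" "x \<in> carrier K" for K :: "'q quandle" and f x
    using longitude_action[OF that(1) _ closed(1) w v_def _ _ that(3)] that(2) l_word l_class
    unfolding Q_def \<kappa>_def by blast
  have \<kappa>: "coloring D Q \<kappa>" "coloring (phi_plus D) Q' \<kappa>'"
    unfolding Q_def \<kappa>_def Q'_def \<kappa>'_def by (intro coloring_edge_element closed)+
  have \<kappa>_car: "\<kappa> e \<in> carrier Q" if "e \<in> edges D" for e
    using that by (simp add: \<kappa>_def Q_def edge_element_closed)
  have \<kappa>'_car: "\<kappa>' E \<in> carrier Q'" if "E \<in> edges (phi_plus D)" for E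
    using that by (simp add: \<kappa>'_def Q'_def edge_element_closed)
  have edge: "Into p \<in> edges D" "Into (opposite p) \<in> edges D" if "p \<in> set v" for p
    using that closed(1) knot(2) by (auto simp: edges_def crossing_closed_def)

  \<comment> \<open>The map from Q(D) to the extended presentation\<close>
  have gen: "gen x \<in> carrier P'" if "x \<in> X'" for x
    using that by (simp add: gen_def P'_def carrier_presented)
  have gen_eval: "qeval P' gen s = qeval P' gen t"
    if "(s, t) \<in> R'" "set_qterm s \<subseteq> X'" "set_qterm t \<subseteq> X'" for s t
    using that unfolding gen_def P'_def by (simp add: qeval_presented qclass_eq_iff qcong_rel)
  obtain \<iota> where \<iota>: "\<iota> \<in> quandle_hom P P'" "\<And>x. x \<in> X \<Longrightarrow> \<iota> (qclass X R (Gen x)) = gen x"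
  proof -
    have "gen \<in> X \<rightarrow> carrier P'"
      using gen by (simp add: X'_def)
    moreover have "qeval P' gen s = qeval P' gen t"
      if "(s, t) \<in> R" "set_qterm s \<subseteq> X" "set_qterm t \<subseteq> X" for s t
      using that by (intro gen_eval) (auto simp: X'_def R'_def)
    ultimately show ?thesis
      using presented_quandle_hom_exists[OF quandles(4)] that unfolding P_def by metis
  qed
  \<comment> \<open>Old generators are identified with elements of Q(D) only through
    \<open>h\<close>, so the map goes back along \<open>h\<close> before sending them to their
    namesakes in \<open>P'\<close>.\<close>
  define \<phi> where "\<phi> = \<iota> \<circ> inv_into (carrier P) h"
  have \<phi>: "\<phi> \<in> quandle_hom Q P'"
    unfolding \<phi>_def using quandle_iso_inv[OF quandles(1)] assms(5) \<iota>(1)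
    by (auto simp: P_def Q_def intro: quandle_hom_comp)
  have h_bij: "bij_betw h (carrier P) (carrier Q)"
    using assms(5) by (simp add: P_def Q_def quandle_iso_def)
  have \<phi>_hX: "\<phi> (hX x) = gen x" if "x \<in> X" for x
    using that \<iota>(2) genP bij_betw_inv_into_left[OF h_bij] by (simp add: \<phi>_def hX_def)

  \<comment> \<open>The universal coloring of the parallel diagram, split into its two
    copies\<close>
  define a1 b1 where "a1 = \<kappa>' \<circ> copy_edge D RightSide" and "b1 = \<kappa>' \<circ> copy_edge D LeftSide"
  note phi1 = coloring_phi_plusD[OF quandles(3) w closed(1) \<kappa>(2), folded a1_def b1_def]
  obtain \<psi> where \<psi>: "\<psi> \<in> quandle_hom Q Q'" "\<And>e. e \<in> edges D \<Longrightarrow> \<psi> (\<kappa> e) = a1 e"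
    using coloring_hom_exists[OF quandles(3) closed(1) phi1(1)] unfolding Q_def \<kappa>_def by metis
  have transport1: "b1 (Into q) = qact Q' (b1 (Into p)) (twist_word D (\<psi> \<circ> \<kappa>) p)"
    if pq: "(p, q) \<in> links v (hd v)" for p q
  proof -
    have "p \<in> set v"
      using pq next_passage_passages[of p q D] knot(1,2) by simp
    then have "twist_word D (\<psi> \<circ> \<kappa>) p = twist_word D a1 p"
      using edge \<psi>(2) by (intro twist_word_cong) simp_all
    then show ?thesis
      using pq phi1(3) unfolding parallel_transport_def knot(1) by fastforce
  qed

  \<comment> \<open>From the parallel diagram to the extended presentation\<close>
  have y_fixed: "qact P' (gen y) (map (apfst gen) L) = gen y"
  proof -
    have "set_qterm (qexp (Gen y) L) \<subseteq> X'"
      using assms(6) by (auto simp: set_qterm_qexp X'_def)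
    then have "qeval P' gen (qexp (Gen y) L) = qeval P' gen (Gen y)"
      by (intro gen_eval) (auto simp: R'_def X'_def)
    then show ?thesis
      by (simp add: qeval_qexp)
  qed
  have gen_y: "gen y \<in> carrier P'"
    by (rule gen) (simp add: X'_def)
  \<comment> \<open>The relation y^L = y enters here: left colors that start with
    \<open>gen y\<close> return to it after one turn.\<close>
  have "qact P' (gen y) (concat (map (twist_word D (\<phi> \<circ> \<kappa>)) v)) = gen y"
    using action[OF _ \<phi> gen_y] quandles(4) map_l[of \<phi> gen, OF \<phi>_hX] y_fixed P'_def by simp
  then obtain b where b: "b (start_edge v) = gen y" "\<And>i. b (Loop i) = gen y"
    "\<And>p q. (p, q) \<in> links v (hd v) \<Longrightarrow> b (Into q) = qact P' (b (Into p)) (twist_word D (\<phi> \<circ> \<kappa>) p)"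
    "\<And>p. b (Into p) = qact P' (gen y) (concat (map (twist_word D (\<phi> \<circ> \<kappa>)) (takeWhile (\<lambda>r. r \<noteq> p) v)))"
    using transport_exists[OF \<open>distinct v\<close>] by metis
  have "twist_word D (\<phi> \<circ> \<kappa>) p \<in> lists (carrier P' \<times> UNIV)" if "p \<in> set v" for p
    using edge[OF that] \<kappa>_car quandle_hom_closed[OF \<phi>] by (auto simp: twist_word_def)
  then have "concat (map (twist_word D (\<phi> \<circ> \<kappa>)) (takeWhile (\<lambda>r. r \<noteq> p) v)) \<in> lists (carrier P' \<times> UNIV)"
    for p
    unfolding in_lists_conv_set by (auto dest!: set_takeWhileD)
  then have b_car: "b e \<in> carrier P'" for e
    using b(2,4) gen_y quandle.qact_closed[OF quandles(4)] by (cases e) simp_all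
  define par where "par = parallel_color D P' (\<phi> \<circ> \<kappa>) b"
  have par: "coloring (phi_plus D) P' par"
    unfolding par_def
  proof (rule coloring_parallel_color[OF quandles(4) w closed(1)])
    show "coloring D P' (\<phi> \<circ> \<kappa>)"
      by (rule coloring_hom_comp[OF \<kappa>(1) \<phi> quandles(2,4) closed(1)])
    show "b \<in> edges D \<rightarrow> carrier P'"
      using b_car by blast
    show "parallel_transport D P' (\<phi> \<circ> \<kappa>) b"
      unfolding parallel_transport_def knot(1) using b(3) by blast
  qed
  have par_copy: "par (copy_edge D s e) = (if s = RightSide then \<phi> \<circ> \<kappa> else b) e" if "e \<in> edges D" for s e
    unfolding par_def by (rule parallel_color_copy[OF w that])
  obtain g where g: "g \<in> quandle_hom Q' P'" "\<And>E. E \<in> edges (phi_plus D) \<Longrightarrow> g (\<kappa>' E) = par E"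
    using coloring_hom_exists[OF quandles(4) closed(2) par] unfolding Q'_def \<kappa>'_def by metis

  \<comment> \<open>From the extended presentation to the parallel diagram\<close>
  define b0 where "b0 = b1 (start_edge v)"
  have b0: "b0 \<in> carrier Q'"
    using phi1(2) knot(4) by (auto simp: b0_def)
  \<comment> \<open>The new generator goes to the color of the left copy at the base point; since
    \<open>y\<close> is not in \<open>X\<close>, the old generators keep their values.\<close>
  define \<sigma> where "\<sigma> = (\<lambda>x. \<psi> (hX x))(y := b0)"
  have \<sigma>_X: "\<sigma> x = \<psi> (hX x)" if "x \<in> X" for x
    using that assms(9) by (auto simp: \<sigma>_def)
  have \<sigma>_y: "\<sigma> y = b0"
    by (simp add: \<sigma>_def)
  obtain f where f: "f \<in> quandle_hom P' Q'" "\<And>x. x \<in> X' \<Longrightarrow> f (gen x) = \<sigma> x"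
  proof -
    have "\<sigma> \<in> X' \<rightarrow> carrier Q'"
      using quandle_hom_closed[OF \<psi>(1) hX] b0 by (auto simp: \<sigma>_def X'_def)
    moreover have "qeval Q' \<sigma> s = qeval Q' \<sigma> t" if "(s, t) \<in> R'" for s t
    proof (cases "(s, t) \<in> R")
      case True
      then have st: "set_qterm s \<subseteq> X" "set_qterm t \<subseteq> X"
        using assms(4) by blast+
      \<comment> \<open>On terms over \<open>X\<close> the evaluation factors through the quandle
        presented by \<open>R\<close>, so the old relations carry over.\<close>
      have eval: "qeval Q' \<sigma> u = (\<psi> \<circ> h) (qclass X R u)" if u: "set_qterm u \<subseteq> X" for u
      proof -
        have "qeval Q' \<sigma> u = qeval Q' ((\<psi> \<circ> h) \<circ> (\<lambda>x. qclass X R (Gen x))) u"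
          using u \<sigma>_X by (intro qeval_cong) (auto simp: hX_def)
        also have "\<dots> = (\<psi> \<circ> h) (qeval P (\<lambda>x. qclass X R (Gen x)) u)"
          using genP u by (intro quandle_hom_qeval[symmetric, of _ P Q' _ X] quandle_hom_comp[OF h \<psi>(1)] quandles) auto
        finally show ?thesis
          using u by (simp add: P_def qeval_presented)
      qed
      have "qclass X R s = qclass X R t"
        using True st by (simp add: qclass_eq_iff qcong_rel)
      then show ?thesis
        using eval st by simp
    next
      case False
      then have st: "s = qexp (Gen y) L" "t = Gen y"
        using that by (auto simp: R'_def)
      \<comment> \<open>Following the left copy once around leads back to its color at the base
        point. By \<open>action\<close> the total word acts as \<open>L\<close>, which gives the new
        relation.\<close>
      have "qact Q' b0 (concat (map (twist_word D (\<psi> \<circ> \<kappa>)) v)) = b0"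
      proof (cases v)
        case (Cons p u)
        have "hd (v @ [hd v]) = p"
          using Cons by simp
        then show ?thesis
          using transport_end[of v "hd v" b1 Q', OF transport1] Cons by (simp add: b0_def)
      qed simp
      then show ?thesis
        using action[OF _ \<psi>(1) b0] quandles(3) map_l[of \<psi> \<sigma>] \<sigma>_X Q'_def
        by (simp add: st qeval_qexp \<sigma>_y)
    qed
    ultimately show ?thesis
      using presented_quandle_hom_exists[OF quandles(3)] that unfolding P'_def gen_def by metis
  qed

  \<comment> \<open>The two maps are mutually inverse\<close>
  have f\<phi>: "f (\<phi> q) = \<psi> q" if q: "q \<in> carrier Q" for q
  proof -
    have inv: "inv_into (carrier P) h q \<in> carrier P" "h (inv_into (carrier P) h q) = q"
      using h_bij q by (simp_all add: bij_betw_inv_into_right bij_betw_def inv_into_into)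
    have "(f \<circ> \<iota>) A = (\<psi> \<circ> h) A" if "A \<in> carrier P" for A
    proof (rule presented_quandle_hom_eq[where f = "f \<circ> \<iota>" and g = "\<psi> \<circ> h" and A = A, OF _ _ quandles(3)])
      show "f \<circ> \<iota> \<in> quandle_hom (presented_quandle X R) Q'" "\<psi> \<circ> h \<in> quandle_hom (presented_quandle X R) Q'"
        using quandle_hom_comp \<iota>(1) f(1) h \<psi>(1) unfolding P_def by blast+
      show "(f \<circ> \<iota>) (qclass X R (Gen x)) = (\<psi> \<circ> h) (qclass X R (Gen x))" if "x \<in> X" for x
        using that f(2) \<iota>(2) \<sigma>_X by (simp add: hX_def X'_def)
      show "A \<in> carrier (presented_quandle X R)"
        using that by (simp add: P_def)
    qed
    from this[OF inv(1)] show ?thesis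
      by (simp add: \<phi>_def inv(2))
  qed
  have g\<psi>: "g (\<psi> q) = \<phi> q" if q: "q \<in> carrier Q" for q
  proof -
    have "(g \<circ> \<psi>) q = \<phi> q"
    proof (rule coloring_hom_eq[where f = "g \<circ> \<psi>" and g = \<phi> and x = q, OF _ _ quandles(4)])
      show "g \<circ> \<psi> \<in> quandle_hom (fundamental_quandle D) P'" "\<phi> \<in> quandle_hom (fundamental_quandle D) P'"
        using quandle_hom_comp[OF \<psi>(1) g(1)] \<phi> unfolding Q_def by blast+
      show "(g \<circ> \<psi>) (edge_element D e) = \<phi> (edge_element D e)" if "e \<in> edges D" for e
        using that \<psi>(2) g(2) copy_edge_closed[OF w that] par_copy[of _ RightSide]
        by (simp add: a1_def flip: \<kappa>_def)
      show "q \<in> carrier (fundamental_quandle D)"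
        using q by (simp add: Q_def)
    qed
    then show ?thesis
      by simp
  qed
  have gb0: "g b0 = gen y"
    using knot(4) g(2) copy_edge_closed[OF w knot(4)] par_copy[OF knot(4), of LeftSide] b(1)
    by (simp add: b0_def b1_def)

  have gf: "g (f A) = A" if A: "A \<in> carrier P'" for A
  proof -
    have "(g \<circ> f) A = id A"
    proof (rule presented_quandle_hom_eq[where f = "g \<circ> f" and g = id and A = A, OF _ _ quandles(4)])
      show "g \<circ> f \<in> quandle_hom (presented_quandle X' R') P'" "id \<in> quandle_hom (presented_quandle X' R') P'"
        using quandle_hom_comp[OF f(1) g(1)] unfolding P'_def by (auto simp: quandle_hom_def)
      show "(g \<circ> f) (qclass X' R' (Gen x)) = id (qclass X' R' (Gen x))" if "x \<in> X'" for x
      proof -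
        have "g (\<sigma> x) = gen x"
          using that gb0 g\<psi>[OF hX] \<phi>_hX \<sigma>_X \<sigma>_y by (auto simp: X'_def)
        then show ?thesis
          using f(2)[OF that] by (simp flip: gen_def)
      qed
      show "A \<in> carrier (presented_quandle X' R')"
        using A by (simp add: P'_def)
    qed
    then show ?thesis
      by simp
  qed

  \<comment> \<open>Both \<open>f \<circ> par\<close> and \<open>\<kappa>'\<close> are colorings of
    \<open>phi_plus D\<close>, hence determined by their entrance colors. The right ones agree by
    \<open>f\<phi>\<close>; the left ones obey the same transport rule and agree at the base
    point.\<close>
  have f_par: "f (par E) = \<kappa>' E" if E: "E \<in> edges (phi_plus D)" for E
  proof -
    define a2 b2 where "a2 = (f \<circ> par) \<circ> copy_edge D RightSide" and "b2 = (f \<circ> par) \<circ> copy_edge D LeftSide"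
    have "coloring (phi_plus D) Q' (f \<circ> par)"
      by (rule coloring_hom_comp[OF par f(1) quandles(4,3) closed(2)])
    note phi2 = coloring_phi_plusD[OF quandles(3) w closed(1) this, folded a2_def b2_def]
    have a12: "a2 e = a1 e" if "e \<in> edges D" for e
      using par_copy[OF that, of RightSide] f\<phi>[OF \<kappa>_car[OF that]] \<psi>(2)[OF that] by (simp add: a2_def)
    have b2: "b2 e = f (b e)" if "e \<in> edges D" for e
      using par_copy[OF that, of LeftSide] by (simp add: b2_def)
    have transport2: "b2 (Into q) = qact Q' (b2 (Into p)) (twist_word D (\<psi> \<circ> \<kappa>) p)"
      if pq: "(p, q) \<in> links v (hd v)" for p q
    proof -
      have "p \<in> set v"
        using pq next_passage_passages[of p q D] knot(1,2) by simp
      then have "twist_word D (\<psi> \<circ> \<kappa>) p = twist_word D a2 p"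
        using edge \<psi>(2) a12 by (intro twist_word_cong) simp_all
      then show ?thesis
        using pq phi2(3) unfolding parallel_transport_def knot(1) by fastforce
    qed
    have start: "b2 (start_edge v) = b1 (start_edge v)"
      using b2[OF knot(4)] b(1) f(2)[of y] by (simp add: X'_def \<sigma>_y b0_def)
    have b12: "b2 e = b1 e" if "e \<in> edges D" for e
    proof (cases "\<exists>p\<in>set v. e = Into p")
      case True
      then show ?thesis
        using transport_unique[of v b2 "\<lambda>p z. qact Q' z (twist_word D (\<psi> \<circ> \<kappa>) p)" b1]
          transport1 transport2 start by blast
    next
      case False
      then show ?thesis
        using that start by (auto simp: knot(3) split: if_splits)
    qed
    have "(f \<circ> par) E = parallel_color D Q' a2 b2 E"
      by (rule phi2(4)[OF E])
    also have "\<dots> = parallel_color D Q' a1 b1 E"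
      using a12 b12 by (rule parallel_color_cong[OF w closed(1) E])
    also have "\<dots> = \<kappa>' E"
      using phi1(4)[OF E] ..
    finally show ?thesis
      by simp
  qed
  have fg: "f (g A) = A" if A: "A \<in> carrier Q'" for A
  proof -
    have "(f \<circ> g) A = id A"
    proof (rule coloring_hom_eq[where f = "f \<circ> g" and g = id and x = A, OF _ _ quandles(3)])
      show "f \<circ> g \<in> quandle_hom (fundamental_quandle (phi_plus D)) Q'"
        "id \<in> quandle_hom (fundamental_quandle (phi_plus D)) Q'"
        using quandle_hom_comp[OF g(1) f(1)] unfolding Q'_def by (auto simp: quandle_hom_def)
      show "(f \<circ> g) (edge_element (phi_plus D) E) = id (edge_element (phi_plus D) E)"
        if "E \<in> edges (phi_plus D)" for E
        using g(2)[OF that] f_par[OF that] by (simp flip: \<kappa>'_def)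
      show "A \<in> carrier (fundamental_quandle (phi_plus D))"
        using A by (simp add: Q'_def)
    qed
    then show ?thesis
      by simp
  qed
  have "f \<in> quandle_iso P' Q'"
    by (rule quandle_isoI[OF f(1) g(1) gf fg])
  then show ?thesis
    unfolding P'_def Q'_def X'_def R'_def by blast
qed

end
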